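(* Let $\widehat M=\begin{pmatrix}\widehat A&\widehat B\\ \widehat C&O\end{pmatrix}\in\mathbb{DC}_z^{n\times n}$, where $\widehat A$ and $\widehat B\widehat C$ are square of the same order and dual Drazin invertible, with $\mathrm{Ind}_s(\widehat A)=i_{\widehat A}$ and $\mathrm{Ind}_s(\widehat B\widehat C)=i_{\widehat B\widehat C}$. Assume $\widehat A\widehat A^\pi\widehat B\widehat C=\widehat B\widehat C\widehat A\widehat A^\pi$ and $\widehat A\widehat A^e\widehat B\widehat C=O$. Then $\widehat M^D=\begin{pmatrix}M_{11}&M_{12}\\ M_{21}&M_{22}\end{pmatrix}$, where, writing $\widehat\Phi=\widehat B\widehat C$ and $s=i_{\widehat B\widehat C}$, $$M_{11}=\sum_{i=0}^{s-1}\widehat\Phi^\pi\widehat\Phi^i\widehat A^{(2i+1)D},\qquad M_{12}=\sum_{i=0}^{s-1}\widehat\Phi^\pi\widehat\Phi^{i}\widehat A^{(2i+2)D}\widehat B+\widehat\Phi^D\widehat A^\pi\widehat B,$$ $$M_{21}=\sum_{i=0}^{s-1}\widehat C\widehat\Phi^\pi\widehat\Phi^i\widehat A^{(2i+2)D}+\widehat C\widehat\Phi^D\widehat A^\pi,$$ $$M_{22}=\sum_{i=0}^{s-1}\widehat C\widehat\Phi^\pi\widehat\Phi^{i}\widehat A^{(2i+3)D}\widehat B-\widehat C\widehat\Phi^{2D}\widehat A\widehat A^\pi\widehat B-\widehat C\widehat\Phi^D\widehat A^D\widehat B.$$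
   Context: Dual numbers: $\varepsilon\neq0$, $\varepsilon^2=0$, commuting with complex matrices. $\mathbb{DC}^{m\times n}$ denotes matrices $\widehat{A}=A+\varepsilon A_0$ with $A,A_0\in\mathbb{C}^{m\times n}$. For complex square $A$, $\mathrm{Ind}(A)$ is the least $k\ge0$ with $\operatorname{rank}A^k=\operatorname{rank}A^{k+1}$ and $A^D$ its Drazin inverse. $\mathbb{DC}_z^{n\times n}$ is the set of $\widehat{A}=A+\varepsilon A_0$ with $(I-AA^D)\big(\sum_{i=1}^{k}A^{k-i}A_0A^{i-1}\big)(I-AA^D)=O$, $k=\mathrm{Ind}(A)$; "dual Drazin invertible" means belonging to this set. For such $\widehat A$, the dual Drazin inverse $\widehat A^D$ is the unique $\widehat X$ with $\widehat A^k\widehat X\widehat A=\widehat A^k$, $\widehat X\widehat A\widehat X=\widehat X$, $\widehat A\widehat X=\widehat X\widehat A$. $\mathrm{Ind}_s(\widehat A):=\mathrm{Ind}(A)$. $\widehat A^{sD}=(\widehat A^D)^s$, $\widehat A^e=\widehat A\widehat A^D$, $\widehat A^\pi=I-\widehat A^e$, $\widehat A^0=I$; empty sums are zero. *)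

theory Defs
  imports "HOL.Complex" "Jordan_Normal_Form.Matrix" "Jordan_Normal_Form.DL_Rank"
begin

text \<open>
  \<open>Dual a b\<close> stands for \<open>a + \<epsilon> b\<close> with complex \<open>a\<close>, \<open>b\<close> and \<open>\<epsilon>\<^sup>2 = 0\<close>. A matrix
  \<open>A + \<epsilon> A\<^sub>0\<close> with complex matrices \<open>A\<close>, \<open>A\<^sub>0\<close> is represented as a matrix over the ring of
  dual complex numbers; see \<open>dual_mat_decomp\<close> below.
\<close>

datatype dual_complex = Dual (std_part: complex) (inf_part: complex)

instantiation dual_complex :: comm_ring_1
begin

definition "0 = Dual 0 0"
definition "1 = Dual 1 0"
definition "- x = Dual (- std_part x) (- inf_part x)"
definition "x + y = Dual (std_part x + std_part y) (inf_part x + inf_part y)"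
definition "x - y = Dual (std_part x - std_part y) (inf_part x - inf_part y)"
definition "x * y = Dual (std_part x * std_part y) (std_part x * inf_part y + inf_part x * std_part y)"

instance
  by standard
    (auto simp: zero_dual_complex_def one_dual_complex_def uminus_dual_complex_def
      plus_dual_complex_def minus_dual_complex_def times_dual_complex_def algebra_simps)

end

lemmas dual_complex_defs =
  zero_dual_complex_def one_dual_complex_def uminus_dual_complex_def
  plus_dual_complex_def minus_dual_complex_def times_dual_complex_def

definition eps :: dual_complex where
  "eps = Dual 0 1"

definition dual_of_complex :: "complex \<Rightarrow> dual_complex" where
  "dual_of_complex z = Dual z 0"

lemma eps_neq_0: "eps \<noteq> 0"
  by (simp add: eps_def zero_dual_complex_def)

lemma eps_squared: "eps * eps = 0"
  by (simp add: eps_def dual_complex_defs)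

lemma Dual_eq: "Dual a b = dual_of_complex a + eps * dual_of_complex b"
  by (simp add: eps_def dual_of_complex_def dual_complex_defs)

abbreviation std_mat :: "dual_complex mat \<Rightarrow> complex mat" where
  "std_mat \<equiv> map_mat std_part"

abbreviation inf_mat :: "dual_complex mat \<Rightarrow> complex mat" where
  "inf_mat \<equiv> map_mat inf_part"

lemma dual_mat_decomp:
  "A = map_mat dual_of_complex (std_mat A) + eps \<cdot>\<^sub>m map_mat dual_of_complex (inf_mat A)"
  by (rule eq_matI) (simp_all flip: Dual_eq)

text \<open>Sums of \<open>nr \<times> nc\<close> matrices; the dimensions determine the value of the empty sum.\<close>

abbreviation msum ::
  "nat \<Rightarrow> nat \<Rightarrow> (nat \<Rightarrow> 'a :: semiring_1 mat) \<Rightarrow> nat set \<Rightarrow> 'a mat" where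
  "msum nr nc f S \<equiv> finsum (module_mat TYPE('a) nr nc) f S"

definition mat_index :: "complex mat \<Rightarrow> nat" where
  "mat_index A = (LEAST k. vec_space.rank (dim_row A) (A ^\<^sub>m k)
                         = vec_space.rank (dim_row A) (A ^\<^sub>m (k + 1)))"

definition is_drazin_inverse :: "nat \<Rightarrow> 'a :: semiring_1 mat \<Rightarrow> 'a mat \<Rightarrow> bool" where
  "is_drazin_inverse k A X \<longleftrightarrow>
     X \<in> carrier_mat (dim_row A) (dim_row A) \<and>
     A ^\<^sub>m k * X * A = A ^\<^sub>m k \<and> X * A * X = X \<and> A * X = X * A"

definition drazin_inverse :: "complex mat \<Rightarrow> complex mat" where
  "drazin_inverse A = (THE X. is_drazin_inverse (mat_index A) A X)"

definition dual_index :: "dual_complex mat \<Rightarrow> nat" where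
  "dual_index A = mat_index (std_mat A)"

text \<open>The \<open>n \<times> n\<close> dual Drazin invertible matrices.\<close>

definition DCz :: "nat \<Rightarrow> dual_complex mat set" where
  "DCz n = {M \<in> carrier_mat n n.
     let A = std_mat M; A0 = inf_mat M; k = mat_index A;
         P = 1\<^sub>m n - A * drazin_inverse A
     in P * msum n n (\<lambda>i. A ^\<^sub>m (k - i) * A0 * A ^\<^sub>m (i - 1)) {1..k} * P = 0\<^sub>m n n}"

definition dual_drazin :: "dual_complex mat \<Rightarrow> dual_complex mat" where
  "dual_drazin A = (THE X. is_drazin_inverse (dual_index A) A X)"

definition dual_core :: "dual_complex mat \<Rightarrow> dual_complex mat" where
  "dual_core A = A * dual_drazin A"

definition dual_spec :: "dual_complex mat \<Rightarrow> dual_complex mat" where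
  "dual_spec A = 1\<^sub>m (dim_row A) - dual_core A"

end

theory Submission
  imports Defs
begin

text \<open>
  A Drazin inverse at any exponent is unique, so it suffices to know that \<open>M\<^sup>D\<close> exists and that the
  displayed matrix is a Drazin inverse of \<open>M\<close> at some exponent.

  Existence: over \<open>\<complex>\<close>, equality of the ranks of \<open>A\<^sup>k\<close> and \<open>A\<^sup>k\<^sup>+\<^sup>1\<close> gives \<open>A\<^sup>k = A\<^sup>k\<^sup>+\<^sup>1 Z\<close>, and the
  same for the transpose makes \<open>A\<close> strongly \<open>\<pi>\<close>-regular. If \<open>S\<close> and \<open>S'\<close> are the infinitesimal parts of
  the \<open>k\<close>-th and \<open>(k+1)\<close>-st powers of \<open>A + \<epsilon>A\<^sub>0\<close>, the condition defining \<open>DCz\<close> says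
  \<open>(I - AA\<^sup>D) S (I - AA\<^sup>D) = 0\<close>, which is exactly what is needed to lift \<open>Z = A\<^sup>D\<close> to a dual solution
  whose infinitesimal part is \<open>(A\<^sup>D)\<^sup>k\<^sup>+\<^sup>1 (S - S' A\<^sup>D)\<close>.

  Formula: all blocks have the form \<open>P\<close>, \<open>QB\<close>, \<open>CR\<close>, \<open>CSB\<close> with square \<open>P, Q, R, S\<close>, so that the
  computation takes place in the ring of \<open>p \<times> p\<close> matrices. There the hypotheses make
  \<open>N = A A\<^sup>\<pi>\<close> commute with \<open>\<Phi>\<close>, give \<open>A\<^sup>D \<Phi> = 0\<close> and \<open>A \<Phi> = \<Phi> N\<close>, and turn all identities into
  normal form computations with words. The blocks of \<open>M\<^sup>m (I - M X)\<close> satisfy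
  \<open>x\<^sub>i\<^sub>+\<^sub>2 = A x\<^sub>i\<^sub>+\<^sub>1 + \<Phi> x\<^sub>i = N x\<^sub>i\<^sub>+\<^sub>1 + \<Phi> x\<^sub>i\<close> and are killed by powers of the commuting elements \<open>N\<close> and
  \<open>\<Phi>\<close>, hence vanish eventually.
\<close>

section \<open>Drazin inverses in monoids and rings\<close>

text \<open>The exponent stays a parameter and need not be an index, so that solutions found at
  different exponents can be compared.\<close>

definition (in monoid) drazin_at :: "nat \<Rightarrow> 'a \<Rightarrow> 'a \<Rightarrow> bool" where
  "drazin_at k a x \<longleftrightarrow> x \<in> carrier G \<and>
     a [^] k \<otimes> x \<otimes> a = a [^] k \<and> x \<otimes> a \<otimes> x = x \<and> a \<otimes> x = x \<otimes> a"

lemma (in monoid) pow_absorb_right: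
  assumes a: "a \<in> carrier G" and z: "z \<in> carrier G"
    and az: "a [^] Suc k \<otimes> z = a [^] k"
  shows "a [^] (k + j) \<otimes> z [^] (j::nat) = a [^] k"
proof (induction j)
  case (Suc j)
  have "a [^] (k + Suc j) = a [^] j \<otimes> a [^] Suc k"
    unfolding nat_pow_mult[OF a] by (simp add: add.commute del: nat_pow_Suc)
  then have "a [^] (k + Suc j) \<otimes> z [^] Suc j = a [^] j \<otimes> (a [^] Suc k \<otimes> z) \<otimes> z [^] j"
    unfolding nat_pow_Suc2[OF z] by (simp add: m_assoc a z)
  also have "\<dots> = a [^] (k + j) \<otimes> z [^] j"
    unfolding az by (simp add: nat_pow_mult add.commute a)
  finally show ?case using Suc by simp
qed (simp add: a)

text \<open>Next to \<open>a [^] k\<close> the one-sided solutions can be exchanged: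
  \<open>a [^] k \<otimes> z = w \<otimes> a [^] k\<close>, by evaluating
  \<open>w \<otimes> a [^] Suc k \<otimes> z\<close> in two ways. So the witness is also
  \<open>w [^] Suc k \<otimes> a [^] k\<close>; the first form evaluates
  \<open>a \<otimes> x\<close>, the second \<open>x \<otimes> a\<close>.\<close>

lemma (in monoid) drazin_at_exists:
  assumes a: "a \<in> carrier G" and z: "z \<in> carrier G" and w: "w \<in> carrier G"
    and az: "a [^] Suc k \<otimes> z = a [^] k" and wa: "w \<otimes> a [^] Suc k = a [^] k"
  shows "\<exists>x. drazin_at k a x"
proof -
  note [simp] = a z w
  note R = pow_absorb_right[OF a z az]
  have L: "w [^] j \<otimes> a [^] (k + j) = a [^] k" for j :: nat
  proof (induction j)
    case (Suc j)
    have "a [^] (k + Suc j) = a [^] Suc k \<otimes> a [^] j"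
      unfolding nat_pow_mult[OF a] by simp
    then have "w [^] Suc j \<otimes> a [^] (k + Suc j) = w [^] j \<otimes> (w \<otimes> a [^] Suc k) \<otimes> a [^] j"
      by (simp add: m_assoc)
    also have "\<dots> = w [^] j \<otimes> a [^] (k + j)"
      unfolding wa by (simp add: nat_pow_mult m_assoc)
    finally show ?case using Suc by simp
  qed simp
  have "a [^] k \<otimes> z = w \<otimes> (a [^] Suc k \<otimes> z)"
    unfolding wa[symmetric] by (simp add: m_assoc del: nat_pow_Suc)
  then have swap1: "a [^] k \<otimes> z = w \<otimes> a [^] k"
    unfolding az .
  have swap: "a [^] k \<otimes> z [^] j = w [^] j \<otimes> a [^] k" for j :: nat
  proof (induction j)
    case (Suc j)
    have "a [^] k \<otimes> z [^] Suc j = w [^] j \<otimes> (a [^] k \<otimes> z)"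
      using Suc by (simp flip: m_assoc)
    then show ?case by (simp add: swap1 m_assoc)
  qed simp
  define x where "x = a [^] k \<otimes> z [^] Suc k"
  have x: "x \<in> carrier G" by (simp add: x_def)
  have ax: "a \<otimes> x = a [^] k \<otimes> z [^] k"
  proof -
    have "a \<otimes> x = (a [^] Suc k \<otimes> z) \<otimes> z [^] k"
      unfolding x_def nat_pow_Suc2[OF z] nat_pow_Suc2[OF a] by (simp add: m_assoc)
    then show ?thesis unfolding az .
  qed
  have xa: "x \<otimes> a = a [^] k \<otimes> z [^] k"
  proof -
    have "x \<otimes> a = w [^] k \<otimes> (w \<otimes> a [^] Suc k)"
      unfolding x_def swap by (simp add: m_assoc)
    then show ?thesis unfolding wa swap .
  qed
  have e: "a [^] k \<otimes> (a [^] k \<otimes> z [^] k) = a [^] k"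
    using R[of k] by (simp add: nat_pow_mult flip: m_assoc)
  have "x \<otimes> a \<otimes> x = x \<otimes> (a \<otimes> x)" using x by (simp add: m_assoc)
  also have "\<dots> = w [^] Suc k \<otimes> (a [^] k \<otimes> (a [^] k \<otimes> z [^] k))"
    unfolding ax unfolding x_def swap[of "Suc k"] by (simp add: m_assoc)
  also have "\<dots> = x" unfolding e unfolding x_def swap ..
  finally have "x \<otimes> a \<otimes> x = x" .
  moreover have "a [^] k \<otimes> x \<otimes> a = a [^] k" using x by (simp add: m_assoc xa e)
  ultimately show ?thesis using x ax xa unfolding drazin_at_def by auto
qed

lemma (in monoid) drazin_at_absorb:
  assumes a: "a \<in> carrier G" and x: "drazin_at k a x"
  shows "a [^] Suc k \<otimes> x = a [^] k" "x \<otimes> a [^] Suc k = a [^] k"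
proof -
  have xc: "x \<in> carrier G" and X: "a [^] k \<otimes> x \<otimes> a = a [^] k" "a \<otimes> x = x \<otimes> a"
    using x by (auto simp: drazin_at_def)
  show right: "a [^] Suc k \<otimes> x = a [^] k" using X a xc by (simp add: m_assoc)
  show "x \<otimes> a [^] Suc k = a [^] k"
    using right group_commutes_pow[OF X(2) a xc, of "Suc k"] by simp
qed

lemma (in monoid) drazin_at_mono:
  assumes a: "a \<in> carrier G" and x: "drazin_at k a x" and le: "k \<le> m"
  shows "drazin_at m a x"
proof -
  have "a [^] m = a [^] (m - k) \<otimes> a [^] k" using le by (simp add: nat_pow_mult a)
  then show ?thesis using a x by (simp add: drazin_at_def m_assoc)
qed

text \<open>Since \<open>a [^] k = a [^] (k + m) \<otimes> z [^] m\<close> and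
  \<open>x \<otimes> a\<close> commutes with the powers of \<open>a\<close>, the equation at the
  exponent \<open>k + m\<close> restricts to \<open>k\<close>.\<close>

lemma (in monoid) drazin_at_lower:
  assumes a: "a \<in> carrier G" and x: "drazin_at m a x" and z: "z \<in> carrier G"
    and az: "a [^] Suc k \<otimes> z = a [^] k"
  shows "drazin_at k a x"
proof -
  have "drazin_at (k + m) a x" by (rule drazin_at_mono[OF a x]) simp
  then have xc: "x \<in> carrier G" and X: "a [^] (k + m) \<otimes> x \<otimes> a = a [^] (k + m)"
      "x \<otimes> a \<otimes> x = x" "a \<otimes> x = x \<otimes> a"
    by (auto simp: drazin_at_def)
  note [simp] = a xc z
  have comm: "a [^] i \<otimes> x \<otimes> a = x \<otimes> a \<otimes> a [^] i" for i :: nat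
    using group_commutes_pow[OF X(3)] group_commutes_pow[of a a i]
    by (simp add: m_assoc)
  note absorb = pow_absorb_right[OF a z az, of m]
  have "a [^] k \<otimes> x \<otimes> a = x \<otimes> a \<otimes> a [^] (k + m) \<otimes> z [^] m"
    unfolding comm by (subst absorb[symmetric]) (simp add: m_assoc)
  also have "\<dots> = a [^] k" unfolding comm[symmetric] X(1) by (rule absorb)
  finally show ?thesis using X xc by (simp add: drazin_at_def)
qed

text \<open>An element \<open>v\<close> with \<open>v \<otimes> a \<otimes> v = v\<close> that
  commutes with \<open>a\<close> is a left and a right multiple of every \<open>a [^] i\<close>, and
  on these \<open>u \<otimes> a\<close> acts as the identity. Hence
  \<open>x = x \<otimes> a \<otimes> y = y\<close> across different exponents.\<close>

lemma (in monoid) drazin_at_unique: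
  assumes a: "a \<in> carrier G" and x: "drazin_at k a x" and y: "drazin_at l a y"
  shows "x = y"
proof -
  have key: "v = u \<otimes> a \<otimes> v" "v = v \<otimes> (a \<otimes> u)"
    if u: "u \<in> carrier G" "a [^] (i::nat) \<otimes> u \<otimes> a = a [^] i" "a \<otimes> u = u \<otimes> a"
      and v: "v \<in> carrier G" "v \<otimes> a \<otimes> v = v" "a \<otimes> v = v \<otimes> a" for u v i
  proof -
    note [simp] = a u(1) v(1)
    have "v = v [^] Suc i \<otimes> a [^] i \<and> v = a [^] i \<otimes> v [^] Suc i"
    proof (induction i)
      case (Suc i)
      have "v [^] Suc (Suc i) \<otimes> a [^] Suc i = v \<otimes> (v [^] Suc i \<otimes> a [^] i) \<otimes> a"
        unfolding nat_pow_Suc2[OF v(1), of "Suc i"] by (simp add: m_assoc)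
      also have "\<dots> = v" using Suc v(2,3) by (simp add: m_assoc)
      moreover have "a [^] Suc i \<otimes> v [^] Suc (Suc i) = a \<otimes> (a [^] i \<otimes> v [^] Suc i) \<otimes> v"
        unfolding nat_pow_Suc2[OF a, of i] by (simp add: m_assoc)
      moreover have "\<dots> = v" using Suc v(2,3) by simp
      ultimately show ?case by simp
    qed simp
    then have v1: "v = v [^] Suc i \<otimes> a [^] i" and v2: "v = a [^] i \<otimes> v [^] Suc i"
      by blast+
    have "u \<otimes> a \<otimes> a [^] i = a [^] i \<otimes> u \<otimes> a"
      using group_commutes_pow[OF u(3)] u(3) group_commutes_pow[of a a i]
      by (simp add: m_assoc)
    then have "u \<otimes> a \<otimes> v = a [^] i \<otimes> v [^] Suc i"
      using u(2) by (subst v2) (simp flip: m_assoc)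
    then show "v = u \<otimes> a \<otimes> v" using v2 by simp
    have "v \<otimes> (a \<otimes> u) = v [^] Suc i \<otimes> (a [^] i \<otimes> u \<otimes> a)"
      unfolding u(3) by (subst v1) (simp add: m_assoc)
    then show "v = v \<otimes> (a \<otimes> u)" using u(2) v1 by simp
  qed
  have "x = x \<otimes> (a \<otimes> y)"
    by (rule key(2)) (use x y in \<open>auto simp: drazin_at_def\<close>)
  also have "\<dots> = x \<otimes> a \<otimes> y" using a x y by (simp add: drazin_at_def m_assoc)
  also have "\<dots> = y"
    by (rule key(1)[symmetric]) (use x y in \<open>auto simp: drazin_at_def\<close>)
  finally show ?thesis .
qed

lemma (in monoid) drazin_at_core_pow:
  assumes a: "a \<in> carrier G" and x: "drazin_at k a x"
  shows "a [^] Suc j \<otimes> x [^] Suc j = a \<otimes> x" "x [^] Suc j \<otimes> a [^] Suc j = a \<otimes> x"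
proof -
  have xc: "x \<in> carrier G" and ax: "a \<otimes> x = x \<otimes> a" and xax: "x \<otimes> a \<otimes> x = x"
    using x by (auto simp: drazin_at_def)
  note [simp] = a xc
  show right: "a [^] Suc j \<otimes> x [^] Suc j = a \<otimes> x"
  proof (induction j)
    case (Suc j)
    have "a [^] Suc (Suc j) \<otimes> x [^] Suc (Suc j) = a \<otimes> (a [^] Suc j \<otimes> x [^] Suc j) \<otimes> x"
      unfolding nat_pow_Suc2[OF a, of "Suc j"] by (simp add: m_assoc)
    also have "\<dots> = a \<otimes> (x \<otimes> a \<otimes> x)" unfolding Suc by (simp add: ax m_assoc)
    finally show ?case unfolding xax .
  qed simp
  have "x [^] Suc j \<otimes> a [^] Suc j = a [^] Suc j \<otimes> x [^] Suc j"
    using ax group_commutes_pow[of a "x [^] Suc j" "Suc j"] group_commutes_pow[of x a "Suc j"]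
    by simp
  then show "x [^] Suc j \<otimes> a [^] Suc j = a \<otimes> x" unfolding right .
qed

text \<open>Double commutant property: the idempotent \<open>e = a \<otimes> x\<close> is both
  \<open>a [^] S \<otimes> x [^] S\<close> and \<open>x [^] S \<otimes> a [^] S\<close>, so
  \<open>e \<otimes> b \<otimes> e\<close> equals \<open>b \<otimes> e\<close> as well as
  \<open>e \<otimes> b\<close>.\<close>

lemma (in monoid) drazin_at_commute:
  assumes a: "a \<in> carrier G" and x: "drazin_at k a x"
    and b: "b \<in> carrier G" and ab: "a \<otimes> b = b \<otimes> a"
  shows "x \<otimes> b = b \<otimes> x"
proof -
  have xc: "x \<in> carrier G" and ax: "a \<otimes> x = x \<otimes> a" and xax: "x \<otimes> a \<otimes> x = x"
    using x by (auto simp: drazin_at_def)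
  note [simp] = a xc b
  \<comment> \<open>The exponent must be positive: for \<open>S = 0\<close> the product
    \<open>a [^] S \<otimes> x [^] S\<close> would be \<open>\<one>\<close>.\<close>
  define S e where "S = Suc k" and "e = a \<otimes> x"
  have e [simp]: "e \<in> carrier G" by (simp add: e_def)
  have e1: "e = a [^] S \<otimes> x [^] S" and e2: "e = x [^] S \<otimes> a [^] S"
    unfolding e_def S_def by (simp_all only: drazin_at_core_pow[OF a x])
  have S: "drazin_at S a x" unfolding S_def by (rule drazin_at_mono[OF a x]) simp
  then have Se: "a [^] S \<otimes> e = a [^] S" by (simp add: drazin_at_def e_def ax m_assoc)
  moreover have "e \<otimes> a [^] S = a [^] S \<otimes> e"
    by (rule group_commutes_pow[symmetric]) (simp_all add: e_def m_assoc flip: ax)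
  ultimately have eS: "e \<otimes> a [^] S = a [^] S" by simp
  have bS: "a [^] S \<otimes> b = b \<otimes> a [^] S" by (rule group_commutes_pow[OF ab]) simp_all
  have "e \<otimes> b \<otimes> e = e \<otimes> (b \<otimes> a [^] S) \<otimes> x [^] S" by (subst (2) e1) (simp add: m_assoc)
  also have "\<dots> = e \<otimes> a [^] S \<otimes> b \<otimes> x [^] S" unfolding bS[symmetric] by (simp add: m_assoc)
  also have "\<dots> = b \<otimes> e" unfolding eS bS by (subst e1) (simp add: m_assoc)
  finally have "e \<otimes> b \<otimes> e = b \<otimes> e" .
  moreover have "e \<otimes> b \<otimes> e = x [^] S \<otimes> (a [^] S \<otimes> b) \<otimes> e" by (subst e2) (simp add: m_assoc)
  then have "e \<otimes> b \<otimes> e = x [^] S \<otimes> b \<otimes> (a [^] S \<otimes> e)" unfolding bS by (simp add: m_assoc)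
  then have "e \<otimes> b \<otimes> e = x [^] S \<otimes> (b \<otimes> a [^] S)" unfolding Se by (simp add: m_assoc)
  then have "e \<otimes> b \<otimes> e = e \<otimes> b" unfolding bS[symmetric] by (subst e2) (simp add: m_assoc)
  ultimately have eb: "e \<otimes> b = b \<otimes> e" by simp
  have xe: "x \<otimes> e = x" using xax by (simp add: e_def flip: m_assoc)
  have ex: "e \<otimes> x = x" using xax by (simp add: e_def ax)
  have "x \<otimes> b = x \<otimes> (e \<otimes> b)" using xe by (simp flip: m_assoc)
  also have "\<dots> = x \<otimes> (b \<otimes> a) \<otimes> x" unfolding eb by (simp add: e_def m_assoc)
  also have "\<dots> = e \<otimes> b \<otimes> x" unfolding ab[symmetric] e_def ax by (simp add: m_assoc)
  also have "\<dots> = b \<otimes> x" unfolding eb using ex by (simp add: m_assoc)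
  finally show ?thesis .
qed

section \<open>Lifting absorption to the infinitesimal part\<close>

lemma (in abelian_group) add_minus_cancel:
  "x \<in> carrier G \<Longrightarrow> y \<in> carrier G \<Longrightarrow> z \<in> carrier G \<Longrightarrow> x \<oplus> y \<oplus> (z \<oplus> \<ominus> y) = x \<oplus> z"
  by (simp add: a_assoc a_lcomm[of y z] r_neg)

text \<open>The conclusions are the infinitesimal parts of the right and left absorption equations
  for the dual element with parts \<open>a\<close> and \<open>b\<close>; \<open>s\<close> and
  \<open>s'\<close> belong to its powers \<open>k\<close> and \<open>Suc k\<close>. Split along
  \<open>p \<oplus> a \<otimes> d = \<one>\<close>: the new summand corrects the
  \<open>a \<otimes> d\<close> component, and the \<open>p\<close> component is right because
  \<open>p\<close> kills \<open>a [^] k\<close> and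
  \<open>p \<otimes> s \<otimes> p = \<zero>\<close>.\<close>

lemma (in ring) lift_absorb:
  assumes a: "a \<in> carrier R" and d: "drazin_at k a d"
    and b: "b \<in> carrier R" and s: "s \<in> carrier R" and s': "s' \<in> carrier R"
    and s'1: "s' = a \<otimes> s \<oplus> b \<otimes> a [^] k" and s'2: "s' = a [^] k \<otimes> b \<oplus> s \<otimes> a"
    and z: "(\<one> \<ominus> a \<otimes> d) \<otimes> s \<otimes> (\<one> \<ominus> a \<otimes> d) = \<zero>"
  shows "a [^] Suc k \<otimes> (d [^] Suc k \<otimes> (s \<ominus> s' \<otimes> d)) \<oplus> s' \<otimes> d = s"
    and "d \<otimes> s' \<oplus> (s \<ominus> d \<otimes> s') \<otimes> d [^] Suc k \<otimes> a [^] Suc k = s"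
proof -
  have dc: "d \<in> carrier R" and ad: "a \<otimes> d = d \<otimes> a"
    and akd: "a [^] k \<otimes> d \<otimes> a = a [^] k"
    using d by (auto simp: drazin_at_def)
  note [simp] = a b dc s
  note e_pow = drazin_at_core_pow(1)[OF a d, of k]
  have e_pow': "d [^] Suc k \<otimes> a [^] Suc k = d \<otimes> a"
    using drazin_at_core_pow(2)[OF a d, of k] by (simp only: ad)
  define p where "p = \<one> \<ominus> a \<otimes> d"
  have pc: "p \<in> carrier R" by (simp add: p_def)
  have split: "p \<otimes> x \<oplus> a \<otimes> d \<otimes> x = x" "x \<otimes> p \<oplus> x \<otimes> (d \<otimes> a) = x"
    if x: "x \<in> carrier R" for x
    using x unfolding p_def by (simp_all add: minus_eq l_distr r_distr l_minus r_minus a_assoc l_neg flip: ad)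
  have psp: "p \<otimes> s \<otimes> p = \<zero>" using z by (simp add: p_def)
  have pa: "p \<otimes> a [^] k = \<zero>"
  proof -
    have "a \<otimes> d \<otimes> a [^] k = a [^] k \<otimes> d \<otimes> a"
      using group_commutes_pow[OF ad] group_commutes_pow[of a a k] ad by (simp add: m_assoc)
    then show ?thesis
      unfolding p_def akd by (simp add: minus_eq l_distr l_minus r_neg)
  qed
  have ap: "a [^] k \<otimes> p = \<zero>"
    using akd unfolding p_def by (simp add: ad minus_eq r_distr r_minus r_neg m_assoc)
  have ps: "p \<otimes> (s' \<otimes> d) = p \<otimes> s"
  proof -
    have "p \<otimes> (s' \<otimes> d) = (p \<otimes> a [^] k) \<otimes> b \<otimes> d \<oplus> p \<otimes> s \<otimes> (d \<otimes> a)"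
      unfolding s'2 using pc by (simp add: l_distr r_distr m_assoc ad)
    also have "\<dots> = p \<otimes> s \<otimes> p \<oplus> p \<otimes> s \<otimes> (d \<otimes> a)"
      unfolding pa psp using pc by simp
    also have "\<dots> = p \<otimes> s" using split(2)[of "p \<otimes> s"] pc by simp
    finally show ?thesis .
  qed
  have sp: "d \<otimes> s' \<otimes> p = s \<otimes> p"
  proof -
    have "d \<otimes> s' \<otimes> p = d \<otimes> a \<otimes> (s \<otimes> p) \<oplus> d \<otimes> b \<otimes> (a [^] k \<otimes> p)"
      unfolding s'1 using pc by (simp add: l_distr r_distr m_assoc)
    also have "\<dots> = p \<otimes> (s \<otimes> p) \<oplus> a \<otimes> d \<otimes> (s \<otimes> p)"
      unfolding ap ad[symmetric] using psp pc by (simp add: m_assoc)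
    also have "\<dots> = s \<otimes> p" using split(1)[of "s \<otimes> p"] pc by simp
    finally show ?thesis .
  qed
  have s'd: "s' \<otimes> d = p \<otimes> s \<oplus> a \<otimes> d \<otimes> (s' \<otimes> d)"
    using split(1)[of "s' \<otimes> d"] s' by (simp add: ps)
  have ds': "d \<otimes> s' = s \<otimes> p \<oplus> d \<otimes> s' \<otimes> (d \<otimes> a)"
    using split(2)[of "d \<otimes> s'"] s' by (simp add: sp)
  have "a [^] Suc k \<otimes> (d [^] Suc k \<otimes> (s \<ominus> s' \<otimes> d)) = a \<otimes> d \<otimes> (s \<ominus> s' \<otimes> d)"
    using s' e_pow by (simp flip: m_assoc del: nat_pow_Suc)
  then have "a [^] Suc k \<otimes> (d [^] Suc k \<otimes> (s \<ominus> s' \<otimes> d)) \<oplus> s' \<otimes> d =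
      (p \<otimes> s \<oplus> a \<otimes> d \<otimes> (s' \<otimes> d)) \<oplus> a \<otimes> d \<otimes> (s \<ominus> s' \<otimes> d)"
    using s' pc by (subst (2) s'd) (simp add: a_comm)
  also have "\<dots> = p \<otimes> s \<oplus> a \<otimes> d \<otimes> s"
    using s' pc by (simp add: minus_eq r_distr r_minus m_assoc add_minus_cancel)
  also have "\<dots> = s" by (rule split(1)) simp
  finally show "a [^] Suc k \<otimes> (d [^] Suc k \<otimes> (s \<ominus> s' \<otimes> d)) \<oplus> s' \<otimes> d = s" .
  have "(s \<ominus> d \<otimes> s') \<otimes> d [^] Suc k \<otimes> a [^] Suc k = (s \<ominus> d \<otimes> s') \<otimes> (d \<otimes> a)"
    using s' e_pow' by (simp add: m_assoc del: nat_pow_Suc)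
  then have "d \<otimes> s' \<oplus> (s \<ominus> d \<otimes> s') \<otimes> d [^] Suc k \<otimes> a [^] Suc k =
      (s \<otimes> p \<oplus> d \<otimes> s' \<otimes> (d \<otimes> a)) \<oplus> (s \<ominus> d \<otimes> s') \<otimes> (d \<otimes> a)"
    by (subst ds') simp
  also have "\<dots> = s \<otimes> p \<oplus> s \<otimes> (d \<otimes> a)"
    using s' pc by (simp add: minus_eq l_distr l_minus m_assoc add_minus_cancel)
  also have "\<dots> = s" by (rule split(2)) simp
  finally show "d \<otimes> s' \<oplus> (s \<ominus> d \<otimes> s') \<otimes> d [^] Suc k \<otimes> a [^] Suc k = s" .
qed

section \<open>Drazin inverses of complex matrices\<close>

lemma (in vec_space) col_space_mult_subset:
  assumes A: "A \<in> carrier_mat n m" and C: "C \<in> carrier_mat m r"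
  shows "col_space (A * C) \<subseteq> col_space A"
proof -
  have "A * C \<in> carrier_mat n r" using assms by simp
  from col_space_eq[OF this] col_space_eq[OF A] show ?thesis
    using A C by (auto simp: assoc_mult_mat_vec[OF A C] intro: mult_mat_vec_carrier)
qed

text \<open>At equal ranks a basis of the smaller column space is an independent set of full size in
  the larger one, so the two spaces coincide. Every column of \<open>A\<close> is then a combination
  of columns of \<open>A * C\<close>, and the coefficient vectors form \<open>Z\<close>.\<close>

lemma (in vec_space) rank_mult_le:
  assumes A: "A \<in> carrier_mat n m" and C: "C \<in> carrier_mat m r"
  shows "rank (A * C) \<le> rank A"
    and "rank (A * C) = rank A \<Longrightarrow> \<exists>Z\<in>carrier_mat r m. A * C * Z = A"
proof -
  let ?V = "span (set (cols A))" and ?W = "span (set (cols (A * C)))"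
  have AC: "A * C \<in> carrier_mat n r" using assms by simp
  have cV: "set (cols A) \<subseteq> carrier_vec n" and cW: "set (cols (A * C)) \<subseteq> carrier_vec n"
    using cols_dim[of A] cols_dim[of "A * C"] A AC by auto
  have sV: "subspace class_ring ?V V" and sW: "subspace class_ring ?W V"
    using cV cW by (simp_all add: span_is_subspace)
  have WV: "?W \<subseteq> ?V" using col_space_mult_subset[OF A C] by (simp add: col_space_def)
  have sWV: "subspace class_ring ?W (vs ?V)" by (rule nested_subspaces[OF sV sW WV])
  interpret VV: vectorspace class_ring "vs ?V" by (rule subspace_is_vs[OF sV])
  interpret WW: vectorspace class_ring "vs ?W" by (rule subspace_is_vs[OF sW])
  have fV: "VV.fin_dim" and fW: "WW.fin_dim"
    using fin_dim_span_cols A AC by blast+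
  show "rank (A * C) \<le> rank A"
    unfolding rank_def using VV.subspace_dim[OF sWV fV] fW by simp
  assume eq: "rank (A * C) = rank A"
  obtain b where b: "finite b" "WW.basis b" using WW.finite_basis_exists[OF fW] by blast
  have bW: "b \<subseteq> ?W" using b(2) by (simp add: WW.basis_def)
  have "card b = VV.dim" using WW.dim_basis[OF b] eq by (simp add: rank_def)
  \<comment> \<open>Independence is carried from one subspace to the other through the ambient
    space.\<close>
  moreover have "lin_indpt b"
    using b(2) span_li_not_depend(2)[OF bW] sW by (simp add: WW.basis_def subspace_def)
  then have "VV.lin_indpt b"
    using span_li_not_depend(2)[of b ?V] sV bW WV by (auto simp: subspace_def)
  ultimately have "VV.basis b"
    using bW WV by (intro VV.dim_li_is_basis[OF fV b(1)]) auto
  then have "?V = span b"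
    using span_li_not_depend(1)[of b ?V] sV bW WV by (auto simp: VV.basis_def subspace_def)
  moreover have "?W = span b"
    using b(2) span_li_not_depend(1)[OF bW] sW by (auto simp: WW.basis_def subspace_def)
  ultimately have VW: "col_space (A * C) = col_space A" by (simp add: col_space_def)
  have "\<exists>v\<in>carrier_vec r. A * C *\<^sub>v v = col A j" if "j < m" for j
  proof -
    have "col A j \<in> col_space A"
      unfolding col_space_def using that A cV by (intro span_mem) (auto simp: cols_def)
    then show ?thesis using col_space_eq[OF AC] A C by (auto simp flip: VW)
  qed
  then obtain f where f: "\<And>j. j < m \<Longrightarrow> f j \<in> carrier_vec r"
      "\<And>j. j < m \<Longrightarrow> A * C *\<^sub>v f j = col A j" by metis
  define Z where "Z = mat_of_cols r (map f [0..<m])"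
  have Z: "Z \<in> carrier_mat r m"
    using mat_of_cols_carrier(1)[of r "map f [0..<m]"] by (simp add: Z_def)
  have "A * C * Z = A"
  proof (rule mat_col_eqI)
    fix j assume j: "j < dim_col A"
    then have jm: "j < m" using A by simp
    then have "col Z j = f j" using f(1) by (simp add: Z_def col_mat_of_cols)
    then show "col (A * C * Z) j = col A j"
      using col_mult2[OF AC Z jm] f(2)[OF jm] by simp
  qed (use A C Z in auto)
  with Z show "\<exists>Z\<in>carrier_mat r m. A * C * Z = A" by blast
qed

section \<open>Transfer to the matrix ring, and existence over a field\<close>

lemma is_drazin_inverse_ring_mat:
  fixes A :: "'a :: comm_ring_1 mat"
  assumes "A \<in> carrier_mat n n"
  shows "is_drazin_inverse k A X \<longleftrightarrow> monoid.drazin_at (ring_mat TYPE('a) n ()) k A X"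
proof -
  interpret R: ring "ring_mat TYPE('a) n ()" by (rule ring_mat)
  show ?thesis
    using assms by (simp add: is_drazin_inverse_def R.drazin_at_def ring_mat_simps
        flip: pow_mat_ring_pow[where b = "()"])
qed

lemma is_drazin_inverse_unique:
  fixes A :: "'a :: comm_ring_1 mat"
  assumes A: "A \<in> carrier_mat n n" and "is_drazin_inverse k A X" "is_drazin_inverse l A Y"
  shows "X = Y"
proof -
  interpret R: ring "ring_mat TYPE('a) n ()" by (rule ring_mat)
  show ?thesis
    using R.drazin_at_unique[of A k X l Y] assms
    by (simp add: is_drazin_inverse_ring_mat ring_mat_simps)
qed

lemma pow_mat_Suc_left:
  fixes A :: "'a :: semiring_1 mat"
  assumes "A \<in> carrier_mat n n"
  shows "A ^\<^sub>m Suc k = A * A ^\<^sub>m k"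
  using assms by (induction k) (auto simp: assoc_mult_mat[of _ n n _ n _ n])

lemma transpose_pow_mat:
  fixes A :: "'a :: comm_semiring_1 mat"
  assumes "A \<in> carrier_mat n n"
  shows "transpose_mat (A ^\<^sub>m k) = transpose_mat A ^\<^sub>m k"
proof (induction k)
  case (Suc k)
  have "transpose_mat (A ^\<^sub>m Suc k) = transpose_mat A * transpose_mat (A ^\<^sub>m k)"
    using transpose_mult[OF pow_carrier_mat[OF assms, of k] assms] by simp
  then show ?case
    using Suc pow_mat_Suc_left[of "transpose_mat A" n k] assms by simp
qed (use assms in auto)

lemma rank_pow_stabilizes:
  fixes A :: "'a :: field mat"
  assumes A: "A \<in> carrier_mat n n"
  shows "\<exists>k. vec_space.rank n (A ^\<^sub>m k) = vec_space.rank n (A ^\<^sub>m (k + 1))"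
proof (rule ccontr)
  interpret vec_space "TYPE('a)" n .
  assume "\<not> ?thesis"
  then have less: "rank (A ^\<^sub>m Suc k) < rank (A ^\<^sub>m k)" for k
    using rank_mult_le(1)[OF pow_carrier_mat[OF A, of k] A] by (simp add: nat_less_le) metis
  have "rank (A ^\<^sub>m k) + k \<le> rank (A ^\<^sub>m 0)" for k
  proof (induction k)
    case (Suc k) then show ?case using less[of k] by linarith
  qed simp
  from this[of "Suc (rank (A ^\<^sub>m 0))"] show False by simp
qed

lemma pow_absorb_of_rank:
  fixes A :: "'a :: field mat"
  assumes A: "A \<in> carrier_mat n n"
    and "vec_space.rank n (A ^\<^sub>m k) = vec_space.rank n (A ^\<^sub>m (k + 1))"
  obtains Z where "Z \<in> carrier_mat n n" "A ^\<^sub>m Suc k * Z = A ^\<^sub>m k"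
proof -
  interpret vec_space "TYPE('a)" n .
  show thesis
    using rank_mult_le(2)[OF pow_carrier_mat[OF A, of k] A] assms(2) that by auto
qed

lemma pow_absorb_mono:
  fixes A :: "'a :: comm_ring_1 mat"
  assumes A: "A \<in> carrier_mat n n" and Z: "Z \<in> carrier_mat n n"
    and abs: "A ^\<^sub>m Suc k * Z = A ^\<^sub>m k" and le: "k \<le> m"
  shows "A ^\<^sub>m Suc m * Z = A ^\<^sub>m m"
  using le
proof (induction m rule: dec_induct)
  case (step m)
  have "A ^\<^sub>m Suc (Suc m) * Z = A * (A ^\<^sub>m Suc m * Z)"
    unfolding pow_mat_Suc_left[OF A, of "Suc m"]
    using A Z by (intro assoc_mult_mat[of _ n n _ n _ n]) auto
  also have "\<dots> = A ^\<^sub>m Suc m" unfolding step.IH by (rule pow_mat_Suc_left[OF A, symmetric])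
  finally show ?case .
qed (rule abs)

lemma drazin_inverse_exists_of_rank:
  fixes A :: "'a :: field mat"
  assumes A: "A \<in> carrier_mat n n"
    and rk: "vec_space.rank n (A ^\<^sub>m k) = vec_space.rank n (A ^\<^sub>m (k + 1))"
  shows "\<exists>X. is_drazin_inverse k A X"
proof -
  interpret R: ring "ring_mat TYPE('a) n ()" by (rule ring_mat)
  have AT: "transpose_mat A \<in> carrier_mat n n" using A by simp
  obtain Z where Z: "Z \<in> carrier_mat n n" "A ^\<^sub>m Suc k * Z = A ^\<^sub>m k"
    using pow_absorb_of_rank[OF A rk] .
  \<comment> \<open>The powers of the transpose are only known to stabilize at some
    \<open>l\<close>, so both solutions are raised to \<open>max k l\<close>; the right solution at
    \<open>k\<close> then brings the exponent back down.\<close>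
  obtain l where "vec_space.rank n (transpose_mat A ^\<^sub>m l) = vec_space.rank n (transpose_mat A ^\<^sub>m (l + 1))"
    using rank_pow_stabilizes[OF AT] by blast
  then obtain W where W: "W \<in> carrier_mat n n"
      "transpose_mat A ^\<^sub>m Suc l * W = transpose_mat A ^\<^sub>m l"
    using pow_absorb_of_rank[OF AT] by metis
  define m where "m = max k l"
  have ZA: "A ^\<^sub>m Suc m * Z = A ^\<^sub>m m"
    by (rule pow_absorb_mono[OF A Z]) (simp add: m_def)
  have "transpose_mat A ^\<^sub>m Suc m * W = transpose_mat A ^\<^sub>m m"
    by (rule pow_absorb_mono[OF AT W]) (simp add: m_def)
  then have "transpose_mat (transpose_mat (A ^\<^sub>m Suc m) * W) = A ^\<^sub>m m"
    unfolding transpose_pow_mat[OF A, symmetric] by simp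
  then have WA: "transpose_mat W * A ^\<^sub>m Suc m = A ^\<^sub>m m"
    using transpose_mult[of "transpose_mat (A ^\<^sub>m Suc m)" n n W n]
      pow_carrier_mat[OF A, of "Suc m"] W(1) by simp
  obtain X where "R.drazin_at m A X"
    using R.drazin_at_exists[of A Z "transpose_mat W" m] A Z(1) W(1) ZA WA
    unfolding ring_mat_simps pow_mat_ring_pow[OF A, where b = "()", symmetric] by auto
  then have "R.drazin_at k A X"
    using R.drazin_at_lower[of A m X Z k] A Z
    unfolding ring_mat_simps pow_mat_ring_pow[OF A, where b = "()", symmetric] by auto
  then show ?thesis using is_drazin_inverse_ring_mat[OF A] by blast
qed

lemma is_drazin_inverse_drazin_inverse:
  assumes A: "A \<in> carrier_mat n n"
  shows "is_drazin_inverse (mat_index A) A (drazin_inverse A)"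
proof -
  have "vec_space.rank n (A ^\<^sub>m mat_index A) = vec_space.rank n (A ^\<^sub>m (mat_index A + 1))"
    using LeastI_ex[OF rank_pow_stabilizes[OF A]] A by (simp add: mat_index_def)
  then obtain X where X: "is_drazin_inverse (mat_index A) A X"
    using drazin_inverse_exists_of_rank[OF A] by blast
  show ?thesis
    unfolding drazin_inverse_def using X is_drazin_inverse_unique[OF A _ X] by (rule theI)
qed

section \<open>Drazin inverses of dual complex matrices\<close>

lemma msum_empty [simp]: "msum nr nc f {} = (0\<^sub>m nr nc :: 'a :: comm_ring_1 mat)"
proof -
  interpret M: abelian_group "module_mat TYPE('a) nr nc" by (rule abelian_group_mat)
  show ?thesis by (simp add: M.finsum_empty module_mat_simps)
qed

lemma msum_insert:
  fixes f :: "nat \<Rightarrow> 'a :: comm_ring_1 mat"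
  assumes "finite S" "j \<notin> S" "\<And>i. f i \<in> carrier_mat nr nc"
  shows "msum nr nc f (insert j S) = f j + msum nr nc f S"
proof -
  interpret M: abelian_group "module_mat TYPE('a) nr nc" by (rule abelian_group_mat)
  show ?thesis using M.finsum_insert[of S j f] assms by (auto simp: module_mat_simps)
qed

lemma msum_closed [simp]:
  fixes f :: "nat \<Rightarrow> 'a :: comm_ring_1 mat"
  assumes "\<And>i. f i \<in> carrier_mat nr nc"
  shows "msum nr nc f S \<in> carrier_mat nr nc"
proof -
  interpret M: abelian_group "module_mat TYPE('a) nr nc" by (rule abelian_group_mat)
  show ?thesis using M.finsum_closed[of f S] assms by (auto simp: module_mat_simps)
qed

lemma msum_cong:
  fixes f :: "nat \<Rightarrow> 'a :: comm_ring_1 mat"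
  assumes "\<And>i. i \<in> S \<Longrightarrow> f i = g i" and "\<And>i. g i \<in> carrier_mat nr nc"
  shows "msum nr nc f S = msum nr nc g S"
proof -
  interpret M: abelian_group "module_mat TYPE('a) nr nc" by (rule abelian_group_mat)
  show ?thesis using assms by (intro M.finsum_cong') (auto simp: module_mat_simps)
qed

lemma mult_msum:
  fixes f :: "nat \<Rightarrow> 'a :: comm_ring_1 mat"
  assumes B: "B \<in> carrier_mat nr n" and f: "\<And>i. f i \<in> carrier_mat n nc" and "finite S"
  shows "B * msum n nc f S = msum nr nc (\<lambda>i. B * f i) S"
  using \<open>finite S\<close>
proof (induction S rule: finite_induct)
  case (insert j S)
  have "B * msum n nc f (insert j S) = B * f j + B * msum n nc f S"
    using insert.hyps f by (simp add: msum_insert mult_add_distrib_mat[OF B f msum_closed[OF f]])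
  then show ?case
    using insert B f by (simp add: msum_insert mult_carrier_mat[OF B f])
qed (use B in simp)

lemma msum_mult:
  fixes f :: "nat \<Rightarrow> 'a :: comm_ring_1 mat"
  assumes B: "B \<in> carrier_mat n nc" and f: "\<And>i. f i \<in> carrier_mat nr n" and "finite S"
  shows "msum nr n f S * B = msum nr nc (\<lambda>i. f i * B) S"
  using \<open>finite S\<close>
proof (induction S rule: finite_induct)
  case (insert j S)
  have "msum nr n f (insert j S) * B = f j * B + msum nr n f S * B"
    using insert.hyps f by (simp add: msum_insert add_mult_distrib_mat[OF f msum_closed[OF f] B])
  then show ?case
    using insert B f by (simp add: msum_insert mult_carrier_mat[OF f B])
qed (use B in simp)

section \<open>Standard and infinitesimal parts of matrices\<close>

lemma std_part_sum: "std_part (sum f S) = (\<Sum>i\<in>S. std_part (f i))"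
  by (induction S rule: infinite_finite_induct) (simp_all add: dual_complex_defs)

lemma inf_part_sum: "inf_part (sum f S) = (\<Sum>i\<in>S. inf_part (f i))"
  by (induction S rule: infinite_finite_induct) (simp_all add: dual_complex_defs)

lemma std_mat_mult:
  assumes "A \<in> carrier_mat nr n" "B \<in> carrier_mat n nc"
  shows "std_mat (A * B) = std_mat A * std_mat B"
  using assms
  by (intro eq_matI) (auto simp: scalar_prod_def std_part_sum times_dual_complex_def)

lemma inf_mat_mult:
  assumes "A \<in> carrier_mat nr n" "B \<in> carrier_mat n nc"
  shows "inf_mat (A * B) = std_mat A * inf_mat B + inf_mat A * std_mat B"
  using assms
  by (intro eq_matI) (auto simp: scalar_prod_def inf_part_sum times_dual_complex_def sum.distrib)

lemma std_mat_one: "std_mat (1\<^sub>m n) = 1\<^sub>m n"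
  by (rule eq_matI) (auto simp: dual_complex_defs)

lemma inf_mat_one: "inf_mat (1\<^sub>m n) = 0\<^sub>m n n"
  by (rule eq_matI) (auto simp: dual_complex_defs)

lemma std_mat_pow:
  assumes "A \<in> carrier_mat n n"
  shows "std_mat (A ^\<^sub>m k) = std_mat A ^\<^sub>m k"
  using assms by (induction k) (auto simp: std_mat_one std_mat_mult[of _ n n _ n])

text \<open>Product rule for powers. At the index of the standard part, this is the sum in the
  definition of \<open>DCz\<close>.\<close>

lemma inf_mat_pow:
  assumes M: "M \<in> carrier_mat n n"
  shows "inf_mat (M ^\<^sub>m k) =
    msum n n (\<lambda>i. std_mat M ^\<^sub>m (k - i) * inf_mat M * std_mat M ^\<^sub>m (i - 1)) {1..k}"
proof (induction k)
  case 0
  then show ?case using M by (simp add: inf_mat_one)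
next
  case (Suc k)
  define A B where "A = std_mat M" and "B = inf_mat M"
  define f g where "f = (\<lambda>i. A ^\<^sub>m (k - i) * B * A ^\<^sub>m (i - 1))"
    and "g = (\<lambda>i. A ^\<^sub>m (Suc k - i) * B * A ^\<^sub>m (i - 1))"
  have A: "A \<in> carrier_mat n n" and B: "B \<in> carrier_mat n n" using M by (simp_all add: A_def B_def)
  have f: "f i \<in> carrier_mat n n" and g: "g i \<in> carrier_mat n n" for i
    unfolding f_def g_def by (intro mult_carrier_mat[of _ n n _ n] pow_carrier_mat A B)+
  \<comment> \<open>Only for \<open>i \<le> k\<close> does truncated subtraction satisfy
    \<open>Suc k - i = Suc (k - i)\<close>; the summand at \<open>Suc k\<close> comes from
    \<open>B * A ^\<^sub>m k\<close>.\<close>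
  have Af: "A * f i = g i" if "i \<in> {1..k}" for i
  proof -
    have "A ^\<^sub>m (Suc k - i) = A * A ^\<^sub>m (k - i)"
      using that unfolding pow_mat_Suc_left[OF A, symmetric] by (simp add: Suc_diff_le del: pow_mat.simps)
    then show ?thesis
      using A B unfolding f_def g_def
      by (simp add: assoc_mult_mat[of _ n n _ n _ n] mult_carrier_mat[of _ n n _ n])
  qed
  have "inf_mat (M ^\<^sub>m Suc k) = A * msum n n f {1..k} + B * A ^\<^sub>m k"
    unfolding pow_mat_Suc_left[OF M] inf_mat_mult[OF M pow_carrier_mat[OF M]]
      std_mat_pow[OF M] Suc f_def A_def B_def ..
  also have "A * msum n n f {1..k} = msum n n (\<lambda>i. A * f i) {1..k}"
    by (rule mult_msum[OF A f]) simp
  also have "\<dots> = msum n n g {1..k}" by (rule msum_cong[OF Af g])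
  also have "\<dots> + B * A ^\<^sub>m k = B * A ^\<^sub>m k + \<dots>"
    by (rule comm_add_mat[OF msum_closed[OF g] mult_carrier_mat[OF B pow_carrier_mat[OF A]]])
  also have "B * A ^\<^sub>m k = g (Suc k)" using A B by (simp add: g_def)
  also have "g (Suc k) + msum n n g {1..k} = msum n n g (insert (Suc k) {1..k})"
    by (rule msum_insert[OF _ _ g, symmetric]) auto
  also have "insert (Suc k) {1..k} = {1..Suc k}" by auto
  finally show ?case unfolding g_def A_def B_def .
qed

definition dual_mat :: "complex mat \<Rightarrow> complex mat \<Rightarrow> dual_complex mat" where
  "dual_mat S T = mat (dim_row S) (dim_col S) (\<lambda>ij. Dual (S $$ ij) (T $$ ij))"

lemma dual_mat_carrier [simp]: "S \<in> carrier_mat nr nc \<Longrightarrow> dual_mat S T \<in> carrier_mat nr nc"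
  unfolding dual_mat_def by (rule carrier_matI) simp_all

lemma std_mat_dual_mat [simp]: "std_mat (dual_mat S T) = S"
  by (rule eq_matI) (auto simp: dual_mat_def)

lemma inf_mat_dual_mat [simp]:
  "S \<in> carrier_mat nr nc \<Longrightarrow> T \<in> carrier_mat nr nc \<Longrightarrow> inf_mat (dual_mat S T) = T"
  by (rule eq_matI) (auto simp: dual_mat_def)

lemma dual_mat_eqI:
  assumes "std_mat A = std_mat B" "inf_mat A = inf_mat B"
  shows "A = B"
  by (subst dual_mat_decomp[of A], subst dual_mat_decomp[of B]) (simp only: assms)

lemma a_minus_ring_mat:
  fixes A :: "'a :: comm_ring_1 mat"
  assumes A: "A \<in> carrier_mat n n" and B: "B \<in> carrier_mat n n"
  shows "A \<ominus>\<^bsub>ring_mat TYPE('a) n ()\<^esub> B = A - B"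
proof -
  interpret R: ring "ring_mat TYPE('a) n ()" by (rule ring_mat)
  have neg: "\<ominus>\<^bsub>ring_mat TYPE('a) n ()\<^esub> B = - B"
    using B by (intro R.minus_equality) (auto simp: ring_mat_simps)
  then show ?thesis
    by (simp only: a_minus_def neg ring_mat_simps minus_add_uminus_mat[OF A B])
qed

text \<open>Membership in \<open>DCz\<close> gives right and left absorption at the index of the
  standard part, hence existence; uniqueness then makes the definite description meaningful.\<close>

lemma dual_drazin_is_drazin_inverse:
  assumes "M \<in> DCz n"
  shows "is_drazin_inverse (dual_index M) M (dual_drazin M)"
proof -
  interpret C: ring "ring_mat TYPE(complex) n ()" by (rule ring_mat)
  interpret R: ring "ring_mat TYPE(dual_complex) n ()" by (rule ring_mat)
  define A B k D where "A = std_mat M" and "B = inf_mat M" and "k = dual_index M"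
    and "D = drazin_inverse A"
  have M: "M \<in> carrier_mat n n" using assms by (simp add: DCz_def)
  have A: "A \<in> carrier_mat n n" and B: "B \<in> carrier_mat n n" using M by (simp_all add: A_def B_def)
  have kA: "k = mat_index A" by (simp add: k_def A_def dual_index_def)
  define S S' where "S = inf_mat (M ^\<^sub>m k)" and "S' = inf_mat (M ^\<^sub>m Suc k)"
  have S: "S \<in> carrier_mat n n" and S': "S' \<in> carrier_mat n n"
    using pow_carrier_mat[OF M, of k] pow_carrier_mat[OF M, of "Suc k"] by (simp_all add: S_def S'_def)
  have S'1: "S' = A * S + B * A ^\<^sub>m k"
    unfolding S'_def pow_mat_Suc_left[OF M]
    using M by (simp add: inf_mat_mult[of _ n n _ n] std_mat_pow A_def B_def S_def)
  have S'2: "S' = A ^\<^sub>m k * B + S * A"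
    using M by (simp add: S'_def inf_mat_mult[of _ n n _ n] std_mat_pow A_def B_def S_def)
  have dD: "is_drazin_inverse k A D"
    using is_drazin_inverse_drazin_inverse[OF A] by (simp add: D_def kA)
  then have D: "D \<in> carrier_mat n n" using A by (simp add: is_drazin_inverse_def)
  have PSP: "(1\<^sub>m n - A * D) * S * (1\<^sub>m n - A * D) = 0\<^sub>m n n"
    using assms by (simp add: DCz_def Let_def S_def inf_mat_pow[OF M] flip: A_def B_def kA D_def)
  have AD: "A * D \<in> carrier_mat n n" using A D by simp
  have S'D: "S' * D \<in> carrier_mat n n" and DS': "D * S' \<in> carrier_mat n n" using S' D by simp_all
  note absorb = C.lift_absorb[of A k D B S S', unfolded ring_mat_simps
      pow_mat_ring_pow[OF A, where b = "()", symmetric] pow_mat_ring_pow[OF D, where b = "()", symmetric]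
      a_minus_ring_mat[OF one_carrier_mat AD] a_minus_ring_mat[OF S S'D] a_minus_ring_mat[OF S DS']
      is_drazin_inverse_ring_mat[OF A, symmetric], OF A dD B S S' S'1 S'2 PSP]
  have akd: "A ^\<^sub>m Suc k * D = A ^\<^sub>m k" and dak: "D * A ^\<^sub>m Suc k = A ^\<^sub>m k"
    using C.drazin_at_absorb[of A k D] A dD
    unfolding ring_mat_simps pow_mat_ring_pow[OF A, where b = "()", symmetric]
      is_drazin_inverse_ring_mat[OF A, symmetric] by auto
  \<comment> \<open>The standard parts are \<open>D\<close> in both cases; the infinitesimal parts
    are the right and left solutions of \<open>C.lift_absorb\<close>.\<close>
  define Z where "Z = dual_mat D (D ^\<^sub>m Suc k * (S - S' * D))"
  define W where "W = dual_mat D ((S - D * S') * D ^\<^sub>m Suc k)"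
  have Z: "Z \<in> carrier_mat n n" and W: "W \<in> carrier_mat n n" using D by (simp_all add: Z_def W_def)
  have infZ: "inf_mat Z = D ^\<^sub>m Suc k * (S - S' * D)" and infW: "inf_mat W = (S - D * S') * D ^\<^sub>m Suc k"
    unfolding Z_def W_def
    by (rule inf_mat_dual_mat[OF D], intro mult_carrier_mat[of _ n n _ n] pow_carrier_mat minus_carrier_mat S S' D)+
  have stdZ: "std_mat Z = D" and stdW: "std_mat W = D" by (simp_all add: Z_def W_def)
  have MZ: "M ^\<^sub>m Suc k * Z = M ^\<^sub>m k"
    using absorb(1) akd
    by (intro dual_mat_eqI)
      (simp_all add: std_mat_mult[OF pow_carrier_mat[OF M] Z] inf_mat_mult[OF pow_carrier_mat[OF M] Z]
        std_mat_pow[OF M] infZ stdZ del: pow_mat.simps(2) flip: S'_def S_def A_def)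
  have WM: "W * M ^\<^sub>m Suc k = M ^\<^sub>m k"
    using absorb(2) dak
    by (intro dual_mat_eqI)
      (simp_all add: std_mat_mult[OF W pow_carrier_mat[OF M]] inf_mat_mult[OF W pow_carrier_mat[OF M]]
        std_mat_pow[OF M] infW stdW del: pow_mat.simps(2) flip: S'_def S_def A_def)
  obtain X where "R.drazin_at k M X"
    using R.drazin_at_exists[of M Z W k] M Z W MZ WM
    unfolding ring_mat_simps pow_mat_ring_pow[OF M, where b = "()", symmetric] by auto
  then have X: "is_drazin_inverse k M X" by (simp add: is_drazin_inverse_ring_mat[OF M])
  show ?thesis
    unfolding dual_drazin_def k_def[symmetric] using X is_drazin_inverse_unique[OF M _ X] by (rule theI)
qed

section \<open>The identities in the ring of square blocks\<close>

locale drazin_pair = ring R for R (structure) +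
  fixes a d f g :: 'a and r s :: nat
  assumes a [simp]: "a \<in> carrier R" and f [simp]: "f \<in> carrier R"
    and ad: "drazin_at r a d" and fg: "drazin_at s f g"
    and nilpotent_part_commutes: "a \<otimes> (\<one> \<ominus> a \<otimes> d) \<otimes> f = f \<otimes> a \<otimes> (\<one> \<ominus> a \<otimes> d)"
    and core_annihilates: "a \<otimes> (a \<otimes> d) \<otimes> f = \<zero>"
begin

text \<open>
  Here \<open>a\<close>, \<open>d\<close>, \<open>f\<close>, \<open>g\<close> play the roles of \<open>A\<close>, \<open>A\<^sup>D\<close>, \<open>\<Phi>\<close>, \<open>\<Phi>\<^sup>D\<close>; the Drazin inverse of \<open>M\<close> will have the
  blocks \<open>y\<close>, \<open>uB\<close>, \<open>Cu\<close>, \<open>CvB\<close> for the elements \<open>y\<close>, \<open>u\<close>, \<open>v\<close> defined below.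
\<close>

definition "n = a \<ominus> a \<otimes> (a \<otimes> d)"

lemma d [simp]: "d \<in> carrier R" and g [simp]: "g \<in> carrier R"
  using ad fg by (auto simp: drazin_at_def)

lemma n [simp]: "n \<in> carrier R"
  by (simp add: n_def)

text \<open>Lets a two-letter rule fire at the head of a longer right-nested product.\<close>

lemma extend_eq:
  assumes "x \<otimes> y = z" "x \<in> carrier R" "y \<in> carrier R" "w \<in> carrier R"
  shows "x \<otimes> (y \<otimes> w) = z \<otimes> w"
  using assms by (simp flip: m_assoc)

lemma da: "d \<otimes> a = a \<otimes> d"
  using ad by (simp add: drazin_at_def)

lemma a_d_d: "a \<otimes> (d \<otimes> d) = d"
  using ad extend_eq[OF da, of d] by (simp add: drazin_at_def m_assoc)

lemma gf: "g \<otimes> f = f \<otimes> g"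
  using fg by (simp add: drazin_at_def)

lemma fgg: "f \<otimes> (g \<otimes> g) = g"
  using fg extend_eq[OF gf, of g] by (simp add: drazin_at_def m_assoc)

lemma df: "d \<otimes> f = \<zero>"
proof -
  \<comment> \<open>Since \<open>d = d \<otimes> d \<otimes> a \<otimes> a \<otimes> d\<close>, the
    annihilated product can be inserted.\<close>
  have "d \<otimes> f = d \<otimes> (d \<otimes> (a \<otimes> (a \<otimes> d) \<otimes> f))"
    using extend_eq[OF da] extend_eq[OF a_d_d] a_d_d by (simp add: m_assoc)
  then show ?thesis unfolding core_annihilates by simp
qed

lemma dg: "d \<otimes> g = \<zero>"
  using extend_eq[OF df, of "g \<otimes> g"] by (simp add: fgg)

lemma nd: "n \<otimes> d = \<zero>"
  by (simp add: n_def minus_eq l_distr l_minus m_assoc a_d_d r_neg)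

lemma dn: "d \<otimes> n = \<zero>"
  using extend_eq[OF da]
  by (simp add: n_def minus_eq r_distr r_minus m_assoc a_d_d da r_neg)

lemma n_eq: "n = a \<otimes> (\<one> \<ominus> a \<otimes> d)"
  by (simp add: n_def minus_eq r_distr r_minus)

lemma nf: "n \<otimes> f = f \<otimes> n"
  using nilpotent_part_commutes by (simp add: n_eq m_assoc)

text \<open>The core part of \<open>a\<close> vanishes to the left of \<open>f\<close>; what remains
  is \<open>n\<close>, which commutes with \<open>f\<close>.\<close>

lemma af: "a \<otimes> f = f \<otimes> n"
proof -
  have "n \<otimes> f = a \<otimes> f" using core_annihilates by (simp add: n_def minus_eq l_distr l_minus)
  then show ?thesis using nf by simp
qed

lemma an: "a \<otimes> n = n \<otimes> n"
proof -
  have "a \<otimes> (a \<otimes> d) \<otimes> n = \<zero>" by (simp add: m_assoc dn)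
  then show ?thesis by (subst (2) n_def) (simp add: minus_eq l_distr l_minus)
qed

lemma na: "n \<otimes> a = n \<otimes> n"
proof -
  have "n \<otimes> (a \<otimes> (a \<otimes> d)) = n \<otimes> (d \<otimes> (a \<otimes> a))"
    by (simp add: extend_eq[OF da] da m_assoc)
  also have "\<dots> = \<zero>" by (simp add: extend_eq[OF nd])
  finally show ?thesis by (subst (3) n_def) (simp add: minus_eq r_distr r_minus)
qed

lemma ng: "n \<otimes> g = g \<otimes> n"
  using drazin_at_commute[OF f fg n] nf by simp

lemma ag: "a \<otimes> g = g \<otimes> n"
proof -
  have "a \<otimes> g = a \<otimes> f \<otimes> (g \<otimes> g)" by (simp add: m_assoc fgg)
  also have "\<dots> = f \<otimes> (g \<otimes> g) \<otimes> n" unfolding af by (simp add: m_assoc ng extend_eq[OF ng])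
  finally show ?thesis by (simp add: fgg)
qed

lemma extend_eq3:
  assumes "x \<otimes> (y \<otimes> z) = v" "x \<in> carrier R" "y \<in> carrier R" "z \<in> carrier R" "w \<in> carrier R"
  shows "x \<otimes> (y \<otimes> (z \<otimes> w)) = v \<otimes> w"
  using assms by (simp flip: m_assoc)

text \<open>As a rewrite system: \<open>f\<close> and \<open>g\<close> move to the front, an
  \<open>a\<close> that they pass becomes \<open>n\<close>, and \<open>d\<close> vanishes before
  \<open>f\<close> or \<open>g\<close> and on either side of \<open>n\<close>.\<close>

lemmas letter_rules = da gf df dg dn nd nf af na an ng ag

lemmas word_rules = letter_rules letter_rules[THEN extend_eq] a_d_d fgg
  a_d_d[THEN extend_eq3] fgg[THEN extend_eq3]

section \<open>The truncated series and its fixpoint equation\<close>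

definition "p = \<one> \<ominus> f \<otimes> g"

definition "T i = p \<otimes> f [^] (i::nat) \<otimes> d [^] (2 * i + 1)"

text \<open>The number of summands is free for the sake of induction; the series of the theorem is
  \<open>Y s\<close>.\<close>

definition "Y m = (\<Oplus>i\<in>{..<m}. T i)"

lemma p [simp]: "p \<in> carrier R"
  by (simp add: p_def)

lemma T [simp]: "T i \<in> carrier R"
  by (simp add: T_def)

lemma Y [simp]: "Y m \<in> carrier R"
  by (simp add: Y_def)

lemma Y_0: "Y 0 = \<zero>"
  by (simp add: Y_def)

lemma Y_Suc: "Y (Suc m) = T m \<oplus> Y m"
  by (simp add: Y_def lessThan_Suc)

lemma gp: "g \<otimes> p = \<zero>"
  by (simp add: p_def minus_eq r_distr r_minus word_rules m_assoc r_neg)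

lemma np: "n \<otimes> p = p \<otimes> n"
  by (simp add: p_def minus_eq l_distr r_distr l_minus r_minus word_rules m_assoc)

lemma fp: "f \<otimes> p = p \<otimes> f"
  by (simp add: p_def minus_eq l_distr r_distr l_minus r_minus word_rules m_assoc)

text \<open>The power \<open>f [^] s\<close> lies in the core of \<open>f\<close>, which
  \<open>p\<close> removes. This makes the term \<open>T s\<close> vanish and lets the series stop
  before it.\<close>

lemma f_pow_p: "f [^] s \<otimes> p = \<zero>" "p \<otimes> f [^] s = \<zero>"
proof -
  have "f [^] s \<otimes> (f \<otimes> g) = f [^] s"
    using fg by (simp add: drazin_at_def m_assoc gf)
  then show "f [^] s \<otimes> p = \<zero>" by (simp add: p_def minus_eq r_distr r_minus r_neg)
  then show "p \<otimes> f [^] s = \<zero>" using group_commutes_pow[OF fp, of s] by simp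
qed

lemma n_f_pow: "n \<otimes> f [^] (i::nat) = f [^] i \<otimes> n"
  using group_commutes_pow[of f n i] nf by simp

lemma n_d_pow: "n \<otimes> d [^] Suc i = \<zero>"
  unfolding nat_pow_Suc2[OF d] by (simp add: word_rules)

lemma d_pow_ad: "d [^] Suc i \<otimes> (a \<otimes> d) = d [^] Suc i"
  by (simp add: m_assoc word_rules)

lemma mult_Y_eq_zero:
  assumes "x \<in> carrier R" "\<And>i. x \<otimes> T i = \<zero>"
  shows "x \<otimes> Y m = \<zero>"
  using assms by (induction m) (simp_all add: Y_0 Y_Suc r_distr)

lemma gY: "g \<otimes> Y m = \<zero>"
  by (rule mult_Y_eq_zero) (simp_all add: T_def extend_eq[OF gp] m_assoc)

lemma nY: "n \<otimes> Y m = \<zero>"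
proof (rule mult_Y_eq_zero)
  fix i
  have "n \<otimes> T i = p \<otimes> f [^] i \<otimes> (n \<otimes> d [^] Suc (2 * i))"
    unfolding T_def by (simp add: m_assoc extend_eq[OF np] extend_eq[OF n_f_pow])
  then show "n \<otimes> T i = \<zero>" unfolding n_d_pow by simp
qed simp

lemma f_pow_Y: "f [^] s \<otimes> Y m = \<zero>"
  by (rule mult_Y_eq_zero) (simp_all add: T_def extend_eq[OF f_pow_p(1)] m_assoc)

lemma Y_ad: "Y m \<otimes> (a \<otimes> d) = Y m"
proof (induction m)
  case (Suc m)
  have "T m \<otimes> (a \<otimes> d) = p \<otimes> f [^] m \<otimes> (d [^] Suc (2 * m) \<otimes> (a \<otimes> d))"
    by (simp add: T_def m_assoc)
  then have "T m \<otimes> (a \<otimes> d) = T m" unfolding d_pow_ad by (simp add: T_def)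
  then show ?case using Suc by (simp add: Y_Suc l_distr)
qed (simp add: Y_0)

text \<open>Multiplying a term by \<open>f\<close> on the left and by \<open>d \<otimes> d\<close>
  on the right gives the next term, so the shifted sum lacks only the first term
  \<open>p \<otimes> d\<close> and gains \<open>T m\<close>.\<close>

lemma Y_shift: "T m \<oplus> Y m = p \<otimes> d \<oplus> f \<otimes> Y m \<otimes> (d \<otimes> d)"
proof (induction m)
  case (Suc m)
  have "f \<otimes> T m \<otimes> (d \<otimes> d) = p \<otimes> (f \<otimes> f [^] m) \<otimes> (d [^] (2 * m + 1) \<otimes> (d \<otimes> d))"
    by (simp add: T_def m_assoc extend_eq[OF fp])
  also have "\<dots> = T (Suc m)"
    unfolding nat_pow_Suc2[OF f, symmetric] T_def by (simp add: m_assoc)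
  finally have "f \<otimes> T m \<otimes> (d \<otimes> d) = T (Suc m)" .
  then have "p \<otimes> d \<oplus> f \<otimes> Y (Suc m) \<otimes> (d \<otimes> d) = T (Suc m) \<oplus> (p \<otimes> d \<oplus> f \<otimes> Y m \<otimes> (d \<otimes> d))"
    by (simp add: Y_Suc l_distr r_distr a_lcomm)
  then show ?case unfolding Suc[symmetric] Y_Suc by simp
qed (simp add: Y_0 T_def)

definition "y = Y s"
definition "u = y \<otimes> d \<oplus> g \<otimes> (\<one> \<ominus> a \<otimes> d)"
definition "v = y \<otimes> (d \<otimes> d) \<ominus> g \<otimes> g \<otimes> n \<ominus> g \<otimes> d"

lemma y [simp]: "y \<in> carrier R" and u [simp]: "u \<in> carrier R" and v [simp]: "v \<in> carrier R"
  by (simp_all add: y_def u_def v_def)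

text \<open>As \<open>T s\<close> vanishes, the shifted sum closes up. This equation stands in for
  the sum in the word computations below.\<close>

lemma y_eq: "y = (d \<ominus> f \<otimes> (g \<otimes> d)) \<oplus> f \<otimes> (y \<otimes> (d \<otimes> d))"
proof -
  have "T s = \<zero>" by (simp add: T_def f_pow_p)
  then show ?thesis
    using Y_shift[of s] by (simp add: y_def p_def minus_eq l_distr l_minus m_assoc)
qed

lemma gy: "g \<otimes> y = \<zero>" and ny: "n \<otimes> y = \<zero>" and yad: "y \<otimes> (a \<otimes> d) = y"
  by (simp_all add: y_def gY nY Y_ad)

lemma ay: "a \<otimes> y = a \<otimes> d"
  by (subst y_eq) (simp add: minus_eq r_distr r_minus word_rules extend_eq[OF ny] m_assoc)

text \<open>As \<open>y\<close> ends in \<open>d\<close> by \<open>yad\<close>, it kills whatever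
  \<open>d\<close> kills.\<close>

lemma y_absorb: "y \<otimes> x = \<zero>" if "d \<otimes> x = \<zero>" "x \<in> carrier R" for x
proof -
  have "y \<otimes> x = y \<otimes> (a \<otimes> (d \<otimes> x))" using that(2) by (subst yad[symmetric]) (simp add: m_assoc)
  then show ?thesis unfolding that(1) by simp
qed

lemma yf: "y \<otimes> f = \<zero>" and yg: "y \<otimes> g = \<zero>" and yn: "y \<otimes> n = \<zero>"
  by (rule y_absorb; simp add: word_rules)+

lemma dy: "d \<otimes> y = d \<otimes> d"
  by (subst y_eq) (simp add: minus_eq r_distr r_minus word_rules)

lemma yy: "y \<otimes> y = y \<otimes> d"
  by (subst (2) y_eq) (simp add: minus_eq r_distr r_minus word_rules extend_eq[OF yf])

lemmas y_letter_rules = gy ny ay yf yg yn dy yy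

lemmas y_rules = word_rules y_letter_rules y_letter_rules[THEN extend_eq] yad yad[THEN extend_eq3]
  m_assoc l_distr r_distr l_minus r_minus minus_eq

section \<open>Block identities of the candidate inverse\<close>

definition "w = a \<otimes> y \<oplus> f \<otimes> u"

lemma w [simp]: "w \<in> carrier R"
  by (simp add: w_def)

lemma add_cancel_ac: "\<lbrakk>x \<in> carrier R; x' \<in> carrier R; z \<in> carrier R\<rbrakk> \<Longrightarrow> x \<oplus> (x' \<oplus> (\<ominus> x \<oplus> z)) = x' \<oplus> z"
  by (simp add: a_lcomm[of x] r_neg2)

text \<open>This identity and the next two give the products of \<open>M\<close> and the candidate,
  in either order, the coefficients \<open>w\<close>, \<open>y\<close>, \<open>y\<close>,
  \<open>u\<close>. The four \<open>X_MX\<close> identities say that the candidate times this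
  product is the candidate.\<close>

lemma M_X_upper: "a \<otimes> u \<oplus> f \<otimes> v = y"
proof -
  have "a \<otimes> u \<oplus> f \<otimes> v = (d \<ominus> f \<otimes> (g \<otimes> d)) \<oplus> f \<otimes> (y \<otimes> (d \<otimes> d))"
    by (simp add: u_def v_def y_rules a_ac add_cancel_ac)
  then show ?thesis unfolding y_eq[symmetric] .
qed

lemma X_M_lower: "u \<otimes> a \<oplus> v \<otimes> f = y"
proof -
  have "u \<otimes> a = y \<oplus> g \<otimes> (a \<ominus> a \<otimes> (a \<otimes> d))"
    by (simp add: u_def y_rules)
  then have "u \<otimes> a = y \<oplus> g \<otimes> n" unfolding n_def[symmetric] .
  moreover have "v \<otimes> f = \<ominus> (g \<otimes> n)" by (simp add: v_def y_rules)
  ultimately show ?thesis by (simp add: a_assoc r_neg)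
qed

lemma X_M_upper: "y \<otimes> a \<oplus> u \<otimes> f = w"
proof -
  have "y \<otimes> a = a \<otimes> d \<ominus> f \<otimes> (g \<otimes> (a \<otimes> d)) \<oplus> f \<otimes> (y \<otimes> d)"
    by (subst y_eq) (simp add: y_rules)
  then show ?thesis by (simp add: w_def u_def y_rules a_ac)
qed

lemma X_MX_11: "y \<otimes> w \<oplus> u \<otimes> f \<otimes> y = y"
  by (simp add: w_def u_def v_def y_rules a_ac)
lemma X_MX_12: "y \<otimes> y \<oplus> u \<otimes> f \<otimes> u = u"
  by (simp add: w_def u_def v_def y_rules a_ac)
lemma X_MX_21: "u \<otimes> w \<oplus> v \<otimes> f \<otimes> y = u"
  by (simp add: w_def u_def v_def y_rules a_ac add_cancel_ac)
lemma X_MX_22: "u \<otimes> y \<oplus> v \<otimes> f \<otimes> u = v"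
  by (simp add: w_def u_def v_def y_rules a_ac)

section \<open>Eventual vanishing of the residue\<close>

lemma n_nilpotent: "n [^] Suc r = \<zero>"
proof -
  \<comment> \<open>By \<open>an\<close>, an \<open>a\<close> in front of \<open>n\<close> may be
    exchanged for \<open>n\<close>, so it remains to see that \<open>a [^] r\<close> kills
    \<open>n\<close>.\<close>
  have "a [^] i \<otimes> n = n [^] Suc i" for i :: nat
  proof (induction i)
    case (Suc i)
    have "a [^] Suc i \<otimes> n = a [^] i \<otimes> n \<otimes> n" by (simp add: m_assoc an)
    then show ?case unfolding Suc by simp
  qed simp
  moreover have "a [^] r \<otimes> n = \<zero>"
  proof -
    have "a [^] r \<otimes> (a \<otimes> (a \<otimes> d)) = a [^] r \<otimes> d \<otimes> a \<otimes> a"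
      by (simp add: m_assoc word_rules)
    also have "\<dots> = a [^] r \<otimes> a" using ad by (simp add: drazin_at_def)
    finally show ?thesis by (simp add: n_def minus_eq r_distr r_minus r_neg)
  qed
  ultimately show ?thesis by (simp only:)
qed

lemma f_pow_f: "z \<in> carrier R \<Longrightarrow> f [^] (i::nat) \<otimes> (f \<otimes> z) = f \<otimes> (f [^] i \<otimes> z)"
  using group_commutes_pow[of f f i] by (simp flip: m_assoc)

text \<open>Annihilation by \<open>a \<otimes> d\<close> propagates along the recurrence and allows
  \<open>a\<close> to be replaced by \<open>n\<close>, which commutes with \<open>f\<close>. Each
  unfolding then collects one more factor \<open>n\<close> or \<open>f\<close>.\<close>

lemma two_step_recurrence_vanishes:
  fixes x :: "nat \<Rightarrow> 'a"
  assumes x: "\<And>i. x i \<in> carrier R"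
    and rec: "\<And>i. x (Suc (Suc i)) = a \<otimes> x (Suc i) \<oplus> f \<otimes> x i"
    and core: "a \<otimes> (d \<otimes> x 0) = \<zero>" "a \<otimes> (d \<otimes> x 1) = \<zero>"
    and f0: "f [^] s \<otimes> x 0 = \<zero>" "f [^] s \<otimes> x 1 = \<zero>"
    and i: "i \<ge> 2 * (Suc r + s)"
  shows "x i = \<zero>"
proof -
  note [simp] = x
  have n_x: "n \<otimes> z = a \<otimes> z" if "a \<otimes> (d \<otimes> z) = \<zero>" "z \<in> carrier R" for z
    using that by (simp add: n_def minus_eq l_distr l_minus m_assoc)
  have core': "a \<otimes> (d \<otimes> x i) = \<zero> \<and> a \<otimes> (d \<otimes> x (Suc i)) = \<zero>" for i
  proof (induction i)
    case (Suc i)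
    have "a \<otimes> (d \<otimes> x (Suc (Suc i))) = a \<otimes> (a \<otimes> (d \<otimes> x (Suc i)))"
      unfolding rec by (simp add: r_distr word_rules m_assoc)
    then show ?case using Suc by simp
  qed (use core in simp)
  have rec': "x (Suc (Suc i)) = n \<otimes> x (Suc i) \<oplus> f \<otimes> x i" for i
    using core'[of i] by (simp add: rec n_x)
  have fs: "f [^] s \<otimes> x i = \<zero> \<and> f [^] s \<otimes> x (Suc i) = \<zero>" for i
  proof (induction i)
    case (Suc i)
    have "f [^] s \<otimes> x (Suc (Suc i)) = n \<otimes> (f [^] s \<otimes> x (Suc i)) \<oplus> f \<otimes> (f [^] s \<otimes> x i)"
      by (simp add: rec' r_distr f_pow_f extend_eq[OF n_f_pow] m_assoc)
    then show ?case using Suc by simp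
  qed (use f0 in simp)
  \<comment> \<open>Here \<open>b\<close> and \<open>c\<close> count collected factors and
    \<open>j\<close> the unfoldings still to come, each lowering the index by at most two. At
    \<open>j = 0\<close>, either \<open>b\<close> has reached \<open>Suc r\<close> or
    \<open>c\<close> has reached \<open>s\<close>.\<close>
  have "n [^] b \<otimes> (f [^] c \<otimes> x i) = \<zero>" if "b + c + j \<ge> Suc r + s" "i \<ge> 2 * j" for b c j i :: nat
    using that
  proof (induction j arbitrary: b c i)
    case 0
    then consider "b \<ge> Suc r" | "c \<ge> s" by linarith
    then show ?case
    proof cases
      case 1
      then have "n [^] b = n [^] Suc r \<otimes> n [^] (b - Suc r)" by (simp only: nat_pow_mult n le_add_diff_inverse)
      then show ?thesis unfolding n_nilpotent by simp
    next
      case 2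
      then have "f [^] c = f [^] (c - s) \<otimes> f [^] s" by (simp add: nat_pow_mult)
      then have "f [^] c \<otimes> x i = \<zero>" using fs[of i] by (simp add: m_assoc)
      then show ?thesis by simp
    qed
  next
    case (Suc j)
    define l where "l = i - 2"
    have l: "i = Suc (Suc l)" "l \<ge> 2 * j" using Suc.prems(2) by (auto simp: l_def)
    have "n [^] b \<otimes> (f [^] c \<otimes> x i) = n [^] Suc b \<otimes> (f [^] c \<otimes> x (Suc l)) \<oplus> n [^] b \<otimes> (f [^] Suc c \<otimes> x l)"
      by (simp add: l(1) rec' r_distr m_assoc extend_eq[OF n_f_pow])
    also have "\<dots> = \<zero>"
      using Suc.IH[of "Suc b" c "Suc l"] Suc.IH[of b "Suc c" l] Suc.prems l(2) by simp
    finally show ?case .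
  qed
  from this[of 0 0 "Suc r + s" i] i show ?thesis by simp
qed

lemma core_w: "a \<otimes> (d \<otimes> (\<one> \<ominus> w)) = \<zero>"
  by (simp add: w_def u_def y_rules r_neg)

text \<open>The contributions \<open>f [^] s \<otimes> (a \<otimes> d)\<close> of
  \<open>a \<otimes> y\<close> and of \<open>f \<otimes> u\<close> cancel, the series dies under
  \<open>f [^] s\<close>, and \<open>f [^] s \<otimes> (f \<otimes> g) = f [^] s\<close> is
  left.\<close>

lemma f_pow_w: "f [^] s \<otimes> (\<one> \<ominus> w) = \<zero>"
proof -
  have "f [^] s \<otimes> (f \<otimes> g) = f [^] s"
    using fg by (simp add: drazin_at_def m_assoc gf)
  note fs = this this[THEN extend_eq3] extend_eq[OF f_pow_Y[of s, folded y_def]]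
  have "f [^] s \<otimes> (f \<otimes> (y \<otimes> d)) = f \<otimes> (f [^] s \<otimes> y) \<otimes> d"
    by (simp add: f_pow_f m_assoc)
  then have fy: "f [^] s \<otimes> (f \<otimes> (y \<otimes> d)) = \<zero>" by (simp add: f_pow_Y y_def)
  show ?thesis
    by (simp add: w_def u_def y_rules fs fy a_lcomm[of "f [^] s \<otimes> (a \<otimes> d)"] r_neg)
qed

lemma residue_vanishes:
  fixes x :: "nat \<Rightarrow> 'a"
  assumes x0: "x 0 = \<one> \<ominus> w" and x1: "x 1 = a \<otimes> (\<one> \<ominus> w) \<ominus> f \<otimes> y"
    and rec: "\<And>i. x (Suc (Suc i)) = a \<otimes> x (Suc i) \<oplus> f \<otimes> x i"
    and i: "i \<ge> 2 * (Suc r + s)"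
  shows "x i = \<zero>"
proof (rule two_step_recurrence_vanishes[where x = x, OF _ rec _ _ _ _ i])
  have "x i \<in> carrier R \<and> x (Suc i) \<in> carrier R" for i
    by (induction i) (simp_all add: x0 x1[simplified] rec)
  then show "x i \<in> carrier R" for i by blast
  define z where "z = \<one> \<ominus> w"
  have z [simp]: "z \<in> carrier R" by (simp add: z_def)
  have core: "a \<otimes> (d \<otimes> z) = \<zero>" unfolding z_def by (rule core_w)
  have fz: "f [^] s \<otimes> z = \<zero>" unfolding z_def by (rule f_pow_w)
  show "a \<otimes> (d \<otimes> x 0) = \<zero>" "f [^] s \<otimes> x 0 = \<zero>"
    using core fz by (simp_all add: x0 flip: z_def)
  have x1': "x 1 = a \<otimes> z \<ominus> f \<otimes> y" by (simp only: x1 z_def)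
  have "a \<otimes> (d \<otimes> x 1) = a \<otimes> (a \<otimes> (d \<otimes> z))"
    unfolding x1' by (simp add: minus_eq r_distr r_minus word_rules m_assoc)
  then show "a \<otimes> (d \<otimes> x 1) = \<zero>" unfolding core by simp
  \<comment> \<open>Only \<open>n\<close> is known to commute with \<open>f\<close>, so
    \<open>a\<close> is exchanged for \<open>n\<close> before \<open>f [^] s\<close> is moved past
    it.\<close>
  have nz: "n \<otimes> z = a \<otimes> z"
    using core by (simp add: n_def minus_eq l_distr l_minus m_assoc)
  have "f [^] s \<otimes> (n \<otimes> z) = n \<otimes> (f [^] s \<otimes> z)"
    by (simp add: extend_eq[OF n_f_pow] m_assoc)
  then have faz: "f [^] s \<otimes> (a \<otimes> z) = \<zero>" unfolding nz fz by simp
  have "f [^] s \<otimes> (f \<otimes> y) = f \<otimes> (f [^] s \<otimes> y)" by (rule f_pow_f) simp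
  also have "f [^] s \<otimes> y = \<zero>" unfolding y_def by (rule f_pow_Y)
  finally have ffy: "f [^] s \<otimes> (f \<otimes> y) = \<zero>" by simp
  show "f [^] s \<otimes> x 1 = \<zero>"
    unfolding x1' by (simp add: minus_eq r_distr r_minus faz ffy)
qed

end

section \<open>Bordered matrices\<close>

text \<open>Fixing the rectangular factors \<open>B\<close> and \<open>C\<close> leaves four square
  coefficients, so block computations take place in one matrix ring even if
  \<open>p \<noteq> q\<close>.\<close>

definition bordered_mat :: "'a :: semiring_0 mat \<Rightarrow> 'a mat \<Rightarrow> 'a mat \<Rightarrow> 'a mat \<Rightarrow> 'a mat \<Rightarrow> 'a mat \<Rightarrow> 'a mat" where
  "bordered_mat B C P Q R S = four_block_mat P (Q * B) (C * R) (C * S * B)"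

lemma bordered_mat_carrier [simp]:
  assumes "B \<in> carrier_mat p q" "C \<in> carrier_mat q p"
    and "P \<in> carrier_mat p p" "Q \<in> carrier_mat p p" "R \<in> carrier_mat p p" "S \<in> carrier_mat p p"
  shows "bordered_mat B C P Q R S \<in> carrier_mat (p + q) (p + q)"
  unfolding bordered_mat_def using assms by (intro four_block_carrier_mat mult_carrier_mat)

text \<open>Where blocks meet, the inner factors combine to the square matrix \<open>B * C\<close>,
  so the form is preserved.\<close>

lemma bordered_mat_mult:
  fixes B :: "'a :: comm_ring_1 mat"
  assumes B: "B \<in> carrier_mat p q" and C: "C \<in> carrier_mat q p"
    and 1: "P \<in> carrier_mat p p" "Q \<in> carrier_mat p p" "R \<in> carrier_mat p p" "S \<in> carrier_mat p p"
    and 2: "P' \<in> carrier_mat p p" "Q' \<in> carrier_mat p p" "R' \<in> carrier_mat p p" "S' \<in> carrier_mat p p"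
  shows "bordered_mat B C P Q R S * bordered_mat B C P' Q' R' S' =
    bordered_mat B C (P * P' + Q * (B * C) * R') (P * Q' + Q * (B * C) * S')
      (R * P' + S * (B * C) * R') (R * Q' + S * (B * C) * S')"
proof -
  note [simp] = B C 1 2
    mult_carrier_mat[of _ p p _ p] mult_carrier_mat[of _ p p _ q] mult_carrier_mat[of _ p q _ p]
    mult_carrier_mat[of _ q p _ p] mult_carrier_mat[of _ q p _ q]
  note assoc = assoc_mult_mat[of _ p p _ p _ p] assoc_mult_mat[of _ p p _ p _ q]
    assoc_mult_mat[of _ p p _ q _ p] assoc_mult_mat[of _ p q _ p _ p] assoc_mult_mat[of _ p q _ p _ q]
    assoc_mult_mat[of _ q p _ p _ p] assoc_mult_mat[of _ q p _ p _ q] assoc_mult_mat[of _ q p _ q _ p]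
    assoc_mult_mat[of _ p p _ q _ q] assoc_mult_mat[of _ q p _ q _ q]
  note distr = add_mult_distrib_mat[of _ p p _ _ q] add_mult_distrib_mat[of _ q p _ _ q] mult_add_distrib_mat[of _ q p _ p]
    mult_add_distrib_mat[of _ q p _ q]
  show ?thesis
    unfolding bordered_mat_def
    by (subst mult_four_block_mat[of _ p p _ q _ q _ _ p _ q]) (simp_all add: assoc distr)
qed

lemma bordered_mat_minus:
  fixes B :: "'a :: comm_ring_1 mat"
  assumes B: "B \<in> carrier_mat p q" and C: "C \<in> carrier_mat q p"
    and 1: "P \<in> carrier_mat p p" "Q \<in> carrier_mat p p" "R \<in> carrier_mat p p" "S \<in> carrier_mat p p"
    and 2: "P' \<in> carrier_mat p p" "Q' \<in> carrier_mat p p" "R' \<in> carrier_mat p p" "S' \<in> carrier_mat p p"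
  shows "bordered_mat B C P Q R S - bordered_mat B C P' Q' R' S' =
    bordered_mat B C (P - P') (Q - Q') (R - R') (S - S')"
proof -
  have "C * (S - S') * B = C * S * B - C * S' * B"
    using assms by (simp add: mult_minus_distrib_mat[of _ q p] minus_mult_distrib_mat[of _ q p])
  moreover have "(Q - Q') * B = Q * B - Q' * B" "C * (R - R') = C * R - C * R'"
    using assms by (simp_all add: mult_minus_distrib_mat[of _ q p _ p] minus_mult_distrib_mat[of _ p p _ _ q])
  ultimately show ?thesis
    unfolding bordered_mat_def using assms by (intro eq_matI) auto
qed

lemma bordered_mat_zero:
  fixes B :: "'a :: comm_ring_1 mat"
  assumes "B \<in> carrier_mat p q" "C \<in> carrier_mat q p"
  shows "bordered_mat B C (0\<^sub>m p p) (0\<^sub>m p p) (0\<^sub>m p p) (0\<^sub>m p p) = 0\<^sub>m (p + q) (p + q)"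
  using assms by (simp add: bordered_mat_def)

fun two_step :: "('b \<Rightarrow> 'b \<Rightarrow> 'b) \<Rightarrow> 'b \<Rightarrow> 'b \<Rightarrow> nat \<Rightarrow> 'b" where
  "two_step h x0 x1 0 = x0"
| "two_step h x0 x1 (Suc 0) = x1"
| "two_step h x0 x1 (Suc (Suc i)) = h (two_step h x0 x1 (Suc i)) (two_step h x0 x1 i)"

lemma add_zero_minus_mat:
  fixes A B :: "'a :: ab_group_add mat"
  shows "A \<in> carrier_mat m n \<Longrightarrow> B \<in> carrier_mat m n \<Longrightarrow> A + (0\<^sub>m m n - B) = A - B"
  by (intro eq_matI) auto

lemma minus_zero_imp_eq:
  fixes A B :: "'a :: ab_group_add mat"
  assumes "A \<in> carrier_mat m n" "B \<in> carrier_mat m n" "A - B = 0\<^sub>m m n"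
  shows "A = B"
proof (rule eq_matI)
  fix i j assume "i < dim_row B" "j < dim_col B"
  then show "A $$ (i, j) = B $$ (i, j)"
    using assms(1,2) arg_cong[OF assms(3), of "\<lambda>Z. Z $$ (i, j)"] by simp
qed (use assms in auto)

lemma finsum_ring_mat:
  fixes f :: "nat \<Rightarrow> 'a :: comm_ring_1 mat"
  assumes "finite S" and f: "\<And>i. f i \<in> carrier_mat n n"
  shows "finsum (ring_mat TYPE('a) n ()) f S = msum n n f S"
  using assms(1)
proof (induction S rule: finite_induct)
  interpret R: ring "ring_mat TYPE('a) n ()" by (rule ring_mat)
  case empty
  show ?case by (simp add: ring_mat_simps)
next
  interpret R: ring "ring_mat TYPE('a) n ()" by (rule ring_mat)
  case (insert j S)
  then show ?case using f by (simp add: msum_insert ring_mat_simps Pi_def)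
qed

text \<open>Some exponent is enough in the conclusion, because Drazin inverses at different
  exponents agree.\<close>

lemma bordered_drazin_inverse:
  fixes A B C D E :: "'a :: comm_ring_1 mat" and p q r s :: nat
  defines "y \<equiv> msum p p (\<lambda>i. (1\<^sub>m p - B * C * E) * (B * C) ^\<^sub>m i * D ^\<^sub>m (2 * i + 1)) {..<s}"
  assumes A: "A \<in> carrier_mat p p" and B: "B \<in> carrier_mat p q" and C: "C \<in> carrier_mat q p"
    and D: "is_drazin_inverse r A D" and E: "is_drazin_inverse s (B * C) E"
    and comm: "A * (1\<^sub>m p - A * D) * (B * C) = B * C * A * (1\<^sub>m p - A * D)"
    and ann: "A * (A * D) * (B * C) = 0\<^sub>m p p"
    and u: "u = y * D + E * (1\<^sub>m p - A * D)"
    and v: "v = y * (D * D) - E * E * (A * (1\<^sub>m p - A * D)) - E * D"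
  shows "\<exists>k. is_drazin_inverse k (four_block_mat A B C (0\<^sub>m q q)) (bordered_mat B C y u u v)"
proof -
  let ?R = "ring_mat TYPE('a) p ()"
  define \<Phi> where "\<Phi> = B * C"
  have \<Phi> [simp]: "\<Phi> \<in> carrier_mat p p" using B C by (simp add: \<Phi>_def)
  have Dc [simp]: "D \<in> carrier_mat p p" and Ec [simp]: "E \<in> carrier_mat p p"
    using D E A B C by (simp_all add: is_drazin_inverse_def)
  note [simp] = A B C mult_carrier_mat[of _ p p _ p] minus_carrier_mat
    left_mult_one_mat[of _ p p] right_mult_one_mat[of _ p p] left_mult_zero_mat[of _ p p]
    right_mult_zero_mat[of _ p p] right_add_zero_mat[of _ p p]
  interpret R: ring ?R by (rule ring_mat)
  interpret P: drazin_pair ?R A D \<Phi> E r s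
  proof
    show "R.drazin_at r A D" "R.drazin_at s \<Phi> E"
      using D E is_drazin_inverse_ring_mat[OF A] is_drazin_inverse_ring_mat[OF \<Phi>]
      by (simp_all flip: \<Phi>_def)
  qed (use comm ann in \<open>simp_all add: ring_mat_simps a_minus_ring_mat flip: \<Phi>_def\<close>)
  have yP: "P.y = y"
    unfolding P.y_def P.Y_def P.T_def P.p_def y_def
    by (subst finsum_ring_mat)
      (simp_all add: ring_mat_simps a_minus_ring_mat minus_carrier_mat \<Phi>_def[symmetric] flip: pow_mat_ring_pow[where b = "()"])
  have y [simp]: "y \<in> carrier_mat p p" using P.y by (simp add: yP ring_mat_simps)
  have nP: "P.n = A * (1\<^sub>m p - A * D)"
    unfolding P.n_eq by (simp add: ring_mat_simps a_minus_ring_mat)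
  have uP: "P.u = u"
    unfolding P.u_def u yP by (simp add: ring_mat_simps a_minus_ring_mat)
  have vP: "P.v = v"
    unfolding P.v_def v yP nP by (simp add: ring_mat_simps a_minus_ring_mat)
  have uc [simp]: "u \<in> carrier_mat p p" and vc [simp]: "v \<in> carrier_mat p p"
    using P.u P.v by (simp_all add: uP vP ring_mat_simps)
  define w where "w = A * y + \<Phi> * u"
  have w [simp]: "w \<in> carrier_mat p p" by (simp add: w_def)
  have wP: "P.w = w" by (simp add: P.w_def w_def yP uP ring_mat_simps)
  note P_eqs = P.M_X_upper P.X_M_lower P.X_M_upper P.X_MX_11 P.X_MX_12 P.X_MX_21 P.X_MX_22
  note eqs = P_eqs[unfolded yP uP vP wP ring_mat_simps]
  let ?M = "four_block_mat A B C (0\<^sub>m q q)" and ?X = "bordered_mat B C y u u v"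
    and ?E = "bordered_mat B C w y y u"
  have M_eq: "?M = bordered_mat B C A (1\<^sub>m p) (1\<^sub>m p) (0\<^sub>m p p)"
    by (simp add: bordered_mat_def left_mult_one_mat[OF B] right_mult_one_mat[OF C]
        right_mult_zero_mat[OF C] left_mult_zero_mat[OF B])
  have M_mult: "?M * bordered_mat B C P Q R S = bordered_mat B C (A * P + \<Phi> * R) (A * Q + \<Phi> * S) P Q"
    if "P \<in> carrier_mat p p" "Q \<in> carrier_mat p p" "R \<in> carrier_mat p p" "S \<in> carrier_mat p p" for P Q R S
    unfolding M_eq using that
    by (subst bordered_mat_mult[OF B C]) (simp_all flip: \<Phi>_def)
  have MX: "?M * ?X = ?E" by (simp add: M_mult eqs(1) flip: w_def)
  have XM: "?X * ?M = ?E"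
    unfolding M_eq by (subst bordered_mat_mult[OF B C]) (simp_all add: eqs(2,3) flip: \<Phi>_def)
  have XE: "?X * ?E = ?X"
    by (subst bordered_mat_mult[OF B C]) (simp_all add: eqs(4-7) flip: \<Phi>_def)
  have M: "?M \<in> carrier_mat (p + q) (p + q)" and X: "?X \<in> carrier_mat (p + q) (p + q)"
    and E: "?E \<in> carrier_mat (p + q) (p + q)"
    using B C by simp_all
  have ME: "?M * ?E \<in> carrier_mat (p + q) (p + q)" by (rule mult_carrier_mat[OF M E])
  define x where "x = two_step (\<lambda>z z'. A * z + \<Phi> * z') (1\<^sub>m p - w) (A * (1\<^sub>m p - w) - \<Phi> * y)"
  have x_rec: "x (Suc (Suc i)) = A * x (Suc i) + \<Phi> * x i" for i by (simp add: x_def)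
  have x_01: "x 0 = 1\<^sub>m p - w" "x (Suc 0) = A * (1\<^sub>m p - w) - \<Phi> * y" by (simp_all add: x_def)
  have x_carrier [simp]: "x i \<in> carrier_mat p p" for i
  proof -
    have "x i \<in> carrier_mat p p \<and> x (Suc i) \<in> carrier_mat p p"
      by (induction i) (simp_all add: x_rec x_01 minus_carrier_mat)
    then show ?thesis by blast
  qed
  define N where "N = 2 * (Suc r + s)"
  have x_vanishes: "x i = 0\<^sub>m p p" if "i \<ge> N" for i
    using P.residue_vanishes[of x i] that
    by (simp add: N_def wP yP ring_mat_simps a_minus_ring_mat x_rec x_01)
  \<comment> \<open>The residue is taken of \<open>?M\<close> rather than of the identity, whose
    lower right block \<open>1\<^sub>m q\<close> is in general not of the form
    \<open>C * S * B\<close>.\<close>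
  define T where "T = ?M - ?M * ?E"
  have Tc: "T \<in> carrier_mat (p + q) (p + q)" unfolding T_def by (rule minus_carrier_mat[OF ME])
  have T: "T = bordered_mat B C (x 1) (x 0) (x 0) (0\<^sub>m p p - y)"
  proof -
    have "A - (A * w + \<Phi> * y) = x 1"
      by (simp add: x_01 mult_minus_distrib_mat[of _ p p _ p] minus_add_minus_mat[of _ p p])
    then show ?thesis
      unfolding T_def M_mult[OF w y y uc] unfolding M_eq
      by (subst bordered_mat_minus[OF B C]) (simp_all add: x_01 flip: w_def)
  qed
  \<comment> \<open>In \<open>T\<close> the coefficient \<open>0\<^sub>m p p - y\<close> acts as the
    term before \<open>x 0\<close>, since the recurrence turns it into \<open>x 1\<close>. Hence the
    pattern in \<open>x\<close> alone starts after one factor \<open>?M\<close>.\<close>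
  have MT: "?M ^\<^sub>m Suc i * T = bordered_mat B C (x (Suc (Suc i))) (x (Suc i)) (x (Suc i)) (x i)" for i
  proof (induction i)
    case 0
    have "A * x 0 + \<Phi> * (0\<^sub>m p p - y) = x 1"
      by (simp add: x_01 mult_minus_distrib_mat[of _ p p _ p] add_zero_minus_mat[of _ p p])
    then show ?case by (simp add: T M_mult x_rec minus_carrier_mat)
  next
    case (Suc i)
    have "?M ^\<^sub>m Suc (Suc i) * T = ?M * (?M ^\<^sub>m Suc i * T)"
      unfolding pow_mat_Suc_left[OF M, of "Suc i"] by (rule assoc_mult_mat[OF M pow_carrier_mat[OF M] Tc])
    then show ?case unfolding Suc by (simp add: M_mult x_rec)
  qed
  note MN = pow_carrier_mat[OF M, of "Suc N"]
  have "?M ^\<^sub>m Suc N * ?M - ?M ^\<^sub>m Suc N * (?M * ?E) = ?M ^\<^sub>m Suc N * T"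
    unfolding T_def by (rule mult_minus_distrib_mat[OF MN M ME, symmetric])
  \<comment> \<open>The coefficients at this power have the indices \<open>N\<close>,
    \<open>Suc N\<close> and \<open>Suc (Suc N)\<close>.\<close>
  also have "\<dots> = 0\<^sub>m (p + q) (p + q)"
    using bordered_mat_zero[OF B C] by (simp only: MT x_vanishes[of "Suc (Suc N)"] x_vanishes[of "Suc N"] x_vanishes[of N] le_SucI le_refl)
  finally have "?M ^\<^sub>m Suc N * ?M = ?M ^\<^sub>m Suc N * (?M * ?E)"
    by (rule minus_zero_imp_eq[OF mult_carrier_mat[OF MN M] mult_carrier_mat[OF MN ME]])
  \<comment> \<open>Writing \<open>?E\<close> as \<open>?X * ?M\<close> gives the defining equation
    at the exponent \<open>Suc (Suc N)\<close>.\<close>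
  also have "\<dots> = ?M ^\<^sub>m Suc N * ?M * (?X * ?M)"
    unfolding XM by (rule assoc_mult_mat[OF MN M E, symmetric])
  also have "\<dots> = ?M ^\<^sub>m Suc N * ?M * ?X * ?M"
    by (rule assoc_mult_mat[OF mult_carrier_mat[OF MN M] X M, symmetric])
  finally have "?M ^\<^sub>m Suc (Suc N) * ?X * ?M = ?M ^\<^sub>m Suc (Suc N)"
    by (simp only: pow_mat.simps(2))
  moreover have "?X * ?M * ?X = ?X"
    unfolding assoc_mult_mat[OF X M X] MX by (rule XE)
  moreover have "?M * ?X = ?X * ?M" unfolding MX XM ..
  ultimately have "is_drazin_inverse (Suc (Suc N)) ?M ?X"
    unfolding is_drazin_inverse_def carrier_matD(1)[OF M] using X by blast
  then show ?thesis by blast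
qed

section \<open>From square coefficients to the displayed block sums\<close>

theorem theorem3p3:
  fixes A B C M \<Phi> :: "dual_complex mat" and p q iA s :: nat
  assumes "A \<in> carrier_mat p p"
    and "B \<in> carrier_mat p q"
    and "C \<in> carrier_mat q p"
    and "M = four_block_mat A B C (0\<^sub>m q q)"
    and "\<Phi> = B * C"
    and "M \<in> DCz (p + q)"
    and "A \<in> DCz p"
    and "\<Phi> \<in> DCz p"
    and "dual_index A = iA"
    and "dual_index \<Phi> = s"
    and "A * dual_spec A * \<Phi> = \<Phi> * A * dual_spec A"
    and "A * dual_core A * \<Phi> = 0\<^sub>m p p"
  shows "dual_drazin M = four_block_mat
    (msum p p (\<lambda>i. dual_spec \<Phi> * \<Phi> ^\<^sub>m i * dual_drazin A ^\<^sub>m (2 * i + 1)) {..<s})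
    (msum p q (\<lambda>i. dual_spec \<Phi> * \<Phi> ^\<^sub>m i * dual_drazin A ^\<^sub>m (2 * i + 2) * B) {..<s}
      + dual_drazin \<Phi> * dual_spec A * B)
    (msum q p (\<lambda>i. C * dual_spec \<Phi> * \<Phi> ^\<^sub>m i * dual_drazin A ^\<^sub>m (2 * i + 2)) {..<s}
      + C * dual_drazin \<Phi> * dual_spec A)
    (msum q q (\<lambda>i. C * dual_spec \<Phi> * \<Phi> ^\<^sub>m i * dual_drazin A ^\<^sub>m (2 * i + 3) * B) {..<s}
      - C * dual_drazin \<Phi> ^\<^sub>m 2 * A * dual_spec A * B
      - C * dual_drazin \<Phi> * dual_drazin A * B)"
proof -
  note A = assms(1) and B = assms(2) and C = assms(3)
  define D E K L where "D = dual_drazin A" and "E = dual_drazin \<Phi>"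
    and "K = dual_spec A" and "L = dual_spec \<Phi>"
  have M: "M \<in> carrier_mat (p + q) (p + q)" using assms(6) by (simp add: DCz_def)
  have \<Phi>: "\<Phi> \<in> carrier_mat p p" using assms(8) by (simp add: DCz_def)
  have D_inv: "is_drazin_inverse iA A D" and E_inv: "is_drazin_inverse s \<Phi> E"
    using dual_drazin_is_drazin_inverse[OF assms(7)] dual_drazin_is_drazin_inverse[OF assms(8)]
    by (simp_all add: D_def E_def assms(9,10))
  have D: "D \<in> carrier_mat p p" and E: "E \<in> carrier_mat p p"
    using D_inv E_inv A \<Phi> by (simp_all add: is_drazin_inverse_def)
  have K_eq: "K = 1\<^sub>m p - A * D" and L_eq: "L = 1\<^sub>m p - \<Phi> * E"
    using A \<Phi> by (simp_all add: K_def L_def D_def E_def dual_spec_def dual_core_def)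
  have K: "K \<in> carrier_mat p p" and L: "L \<in> carrier_mat p p"
    unfolding K_eq L_eq using A D E \<Phi> by (simp_all add: minus_carrier_mat mult_carrier_mat[of _ p p])
  note carriers = A B C D E K L \<Phi> pow_carrier_mat[OF \<Phi>] pow_carrier_mat[OF D]
  define T where "T = (\<lambda>i. L * \<Phi> ^\<^sub>m i * D ^\<^sub>m (2 * i + 1))"
  define y where "y = msum p p T {..<s}"
  define u where "u = y * D + E * K"
  define v where "v = y * (D * D) - E * E * (A * K) - E * D"
  have pow: "L * \<Phi> ^\<^sub>m i * D ^\<^sub>m j \<in> carrier_mat p p" for i j
    by (intro mult_carrier_mat[of _ p p _ p] carriers)
  have T: "T i \<in> carrier_mat p p" for i unfolding T_def by (rule pow)
  have y: "y \<in> carrier_mat p p" unfolding y_def by (rule msum_closed[OF T])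
  note [simp] = carriers y mult_carrier_mat[of _ p p _ p] mult_carrier_mat[of _ p p _ q]
    mult_carrier_mat[of _ q p _ p] mult_carrier_mat[of _ q p _ q]
  note assoc = assoc_mult_mat[of _ p p _ p _ p] assoc_mult_mat[of _ p p _ p _ q]
    assoc_mult_mat[of _ q p _ p _ p] assoc_mult_mat[of _ q p _ p _ q]
  have "2 * i + 2 = Suc (2 * i + 1)" "2 * i + 3 = Suc (2 * i + 2)" for i :: nat by simp_all
  then have pow_Suc: "D ^\<^sub>m (2 * i + 2) = D ^\<^sub>m (2 * i + 1) * D" "D ^\<^sub>m (2 * i + 3) = D ^\<^sub>m (2 * i + 2) * D" for i
    by (simp_all only: pow_mat.simps(2))
  have shift: "T i * D = L * \<Phi> ^\<^sub>m i * D ^\<^sub>m (2 * i + 2)"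
    "T i * (D * D) = L * \<Phi> ^\<^sub>m i * D ^\<^sub>m (2 * i + 3)" for i
    unfolding T_def pow_Suc by (simp_all add: assoc del: pow_mat.simps)
  \<comment> \<open>The offset \<open>j\<close> tells the series apart: \<open>T\<close> has offset
    1, and right factors \<open>D\<close> and \<open>D * D\<close> raise it to 2 and 3.\<close>
  define S where "S = (\<lambda>j i. L * \<Phi> ^\<^sub>m i * D ^\<^sub>m (2 * i + j))"
  have S: "S j i \<in> carrier_mat p p" for i j unfolding S_def by (rule pow)
  have CS: "C * S j i = C * L * \<Phi> ^\<^sub>m i * D ^\<^sub>m (2 * i + j)" for i j
    unfolding S_def by (simp add: assoc)
  have CS_carrier: "C * S j i \<in> carrier_mat q p" for i j
    by (rule mult_carrier_mat[OF C S])
  have yD: "y * D = msum p p (S 2) {..<s}"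
    unfolding y_def msum_mult[of D p p T p, OF D T finite_lessThan] shift S_def ..
  have yDD: "y * (D * D) = msum p p (S 3) {..<s}"
    unfolding y_def msum_mult[of "D * D" p p T p, OF mult_carrier_mat[OF D D] T finite_lessThan] shift S_def ..
  have uB: "u * B = msum p q (\<lambda>i. S 2 i * B) {..<s} + E * K * B"
    unfolding u_def yD[symmetric] msum_mult[of B p q "S 2" p, OF B S finite_lessThan, symmetric]
    by (rule add_mult_distrib_mat[of _ p p _ _ q]) simp_all
  have Cu: "C * u = msum q p (\<lambda>i. C * S 2 i) {..<s} + C * E * K"
  proof -
    have "C * u = C * (y * D) + C * (E * K)"
      unfolding u_def by (rule mult_add_distrib_mat[of _ q p _ p]) simp_all
    also have "C * (E * K) = C * E * K" by (rule assoc_mult_mat[OF C E K, symmetric])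
    finally show ?thesis unfolding yD mult_msum[of C q p "S 2" p, OF C S finite_lessThan] .
  qed
  have CvB: "C * v * B = msum q q (\<lambda>i. C * S 3 i * B) {..<s} - C * E ^\<^sub>m 2 * A * K * B - C * E * D * B"
  proof -
    have c: "y * (D * D) \<in> carrier_mat p p" "E * E * (A * K) \<in> carrier_mat p p" "E * D \<in> carrier_mat p p"
      by simp_all
    have "C * v = C * (y * (D * D)) - C * (E * E * (A * K)) - C * (E * D)"
      unfolding v_def mult_minus_distrib_mat[OF C minus_carrier_mat[OF c(2)] c(3)]
        mult_minus_distrib_mat[OF C c(1,2)] ..
    then have "C * v * B = C * (y * (D * D)) * B - C * (E * E * (A * K)) * B - C * (E * D) * B"
      using minus_mult_distrib_mat[OF minus_carrier_mat[OF mult_carrier_mat[OF C c(2)]] mult_carrier_mat[OF C c(3)] B]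
        minus_mult_distrib_mat[OF mult_carrier_mat[OF C c(1)] mult_carrier_mat[OF C c(2)] B] by simp
    also have "C * (y * (D * D)) * B = msum q q (\<lambda>i. C * S 3 i * B) {..<s}"
      unfolding yDD mult_msum[of C q p "S 3" p, OF C S finite_lessThan]
      by (rule msum_mult[OF B CS_carrier finite_lessThan])
    also have "C * (E * E * (A * K)) * B = C * E ^\<^sub>m 2 * A * K * B"
      by (simp add: assoc numeral_2_eq_2 left_mult_one_mat[OF E])
    also have "C * (E * D) * B = C * E * D * B" by (simp add: assoc)
    finally show ?thesis .
  qed
  have "\<exists>k. is_drazin_inverse k (four_block_mat A B C (0\<^sub>m q q)) (bordered_mat B C y u u v)"
    unfolding y_def T_def L_eq assms(5)
  proof (rule bordered_drazin_inverse[OF A B C D_inv E_inv[unfolded assms(5)]])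
    show "A * (1\<^sub>m p - A * D) * (B * C) = B * C * A * (1\<^sub>m p - A * D)"
      using assms(11) by (simp only: K_def[symmetric] K_eq assms(5))
    show "A * (A * D) * (B * C) = 0\<^sub>m p p"
      using assms(12) by (simp only: dual_core_def D_def assms(5))
    show "u = msum p p (\<lambda>i. (1\<^sub>m p - B * C * E) * (B * C) ^\<^sub>m i * D ^\<^sub>m (2 * i + 1)) {..<s} * D
        + E * (1\<^sub>m p - A * D)"
      by (simp only: u_def y_def T_def L_eq K_eq assms(5))
    show "v = msum p p (\<lambda>i. (1\<^sub>m p - B * C * E) * (B * C) ^\<^sub>m i * D ^\<^sub>m (2 * i + 1)) {..<s} * (D * D)
        - E * E * (A * (1\<^sub>m p - A * D)) - E * D"
      by (simp only: v_def y_def T_def L_eq K_eq assms(5))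
  qed
  then obtain k where "is_drazin_inverse k M (bordered_mat B C y u u v)"
    unfolding assms(4) by blast
  \<comment> \<open>The exponent \<open>k\<close> may differ from \<open>dual_index M\<close>, at
    which membership in \<open>DCz\<close> provides the inverse; uniqueness across exponents
    identifies the two.\<close>
  then have "dual_drazin M = bordered_mat B C y u u v"
    using is_drazin_inverse_unique[OF M dual_drazin_is_drazin_inverse[OF assms(6)]] by blast
  then show ?thesis
    unfolding bordered_mat_def uB Cu CvB CS unfolding S_def y_def T_def D_def E_def K_def L_def .
qed

end
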